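(* Let $n\ge1$. Put $$F(x,t)=e_{q,t^{-2}}(x)\,\frac{(b_6xt^{-1};q)_\infty}{(b_2x,b_3x;q)_\infty}\,C(t),$$ where $C(t)$ is a non-zero solution, independent of $x$, of the first-order $q$-difference equation in $t$ $$\frac{\gamma_n(qt)\,C(qt)}{\gamma_n(t)\,C(t)}=\frac{b_6qt}{g\,(f-b_5qt)},$$ with $f=f_n(t)$, $g=g_n(t)$ here and below. Then $U(x;t):=p_n(x;t)/F(x,t)$ satisfies the mixed divided-difference equation $$t^2U(x;t)-(1-fx)\,U(qx;t)-\frac{x-g}{qgx}\,U(qx;qt)=0$$ and the second-order $q$-difference equation $$\frac{\prod_{j=1}^4(1-b_jx)}{t^2x(x-g)}U(qx;t)+\Bigg[-\frac{\prod_{j=1}^4(1-b_jx)}{x(x-g)(1-fx)}+\frac{x\prod_{j=1}^4(f-b_j)}{f(1-fg)(1-fx)}-\frac{x(f-b_5qt)(b_5f-t)}{b_5qt^2f}$$ $$-\frac{(x-b_6qt)(b_6x-qt)(q-fx)}{b_6qt^2x(x-qg)}\Bigg]U(x;t)+\frac{(x-b_6qt)(b_6x-qt)}{b_6x(x-qg)}U(q^{-1}x;t)=0.$$ Consequently, with the identification $U(x;t)=\tilde Y(q^{-1}x;t)$, i.e. $\tilde Y(z;t):=U(qz;t)$, these two equations agree with the (transformed) Lax pair of Yamada for the $E_6^{(1)}$ $q$-Painlevé system, namely $$\frac{qt^2}{fz}\tilde Y(q^{-1}z;t)-q\frac{1-fz}{fz}\tilde Y(z;t)-\frac{z-g}{fgz^2}\tilde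 Y(z;qt)=0$$ and $$\frac{\prod_{j=1}^4(1-b_jz)}{t^2z(z-g)}\tilde Y(z;t)+\Bigg[-\frac{\prod_{j=1}^4(1-b_jz)}{z(z-g)(1-fz)}+\frac{z\prod_{j=1}^4(b_j-f)}{f(1-fg)(1-fz)}-\frac{z(f-b_5qt)(b_5f-t)}{b_5qt^2f}$$ $$-\frac{(z-b_6qt)(b_6z-qt)(q-fz)}{b_6qt^2z(z-qg)}\Bigg]\tilde Y(q^{-1}z;t)+\frac{(z-b_6qt)(b_6z-qt)}{b_6z(z-qg)}\tilde Y(q^{-2}z;t)=0.$$
   Context: Fix $q$ with $0<|q|<1$, $(a;q)_\infty=\prod_{j\ge0}(1-aq^j)$, $(a_1,\dots,a_m;q)_\infty=\prod_i(a_i;q)_\infty$. For $s\neq0$, $e_{q,s}(z)$ is a $q$-character: a not identically zero (meromorphic) function with $e_{q,s}(qz)=s\,e_{q,s}(z)$ and $e_{q,qs}(z)=z\,e_{q,s}(z)$. Let $b_1,b_2,b_3,b_4,b_6$ be nonzero complex parameters with $b_1b_2b_3b_4=1$, and let $t\ne0$ be the deformation variable, ranging over a lattice $t_0q^{\mathbb Z}$. All parameters and variables are generic, so that $b_5^2\ne q^{-1},1,q$ (with $b_5$ as below) and all denominators occurring are nonzero. The weight is $$w(x;t)=\frac{(b_2x,b_3x,b_6^{-1}xt^{-1};q)_\infty}{(b_1x,b_4x,b_6xt^{-1};q)_\infty}.$$ Put $$D_+(x;t)=b_6(1-b_1x)(1-b_4x)(t-b_6x),\qquad D_-(x;t)=(1-b_2x)(1-b_3x)(b_6t-x),$$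 $$E_+(x;t)=b_6^{-1}(b_6qt-x),\qquad E_-(x;t)=qt-b_6x,$$ so that $w(qx;t)/w(x;t)=D_+/D_-$ and $w(x;qt)/w(x;t)=E_+/E_-$. Orthogonality is with respect to a Thomae–Jackson $q$-integral $\int_G$ in $x$ whose terminals coincide with zeros/poles of the weight, so that boundary terms vanish. Concretely, the Stieltjes function $\phi(x;t)=\int_G \frac{w(y;t)}{x-y}$ satisfies $D_-(x;t)\phi(qx;t)=D_+(x;t)\phi(x;t)+(q-1)x\,\mathcal U(x;t)$ and $E_-(x;t)\phi(x;qt)=E_+(x;t)\phi(x;t)+(q-1)t\,\mathcal T(x;t)$ with $\mathcal U,\mathcal T$ polynomial in $x$. The orthonormal polynomials $p_n(x;t)=\gamma_nx^n+\cdots$ ($\int_G w\,p_np_m=\delta_{nm}$, leading coefficient $\gamma_n=\gamma_n(t)\ne0$) are assumed to exist for all $n\ge0$. Functions of the second kind: $q_n(x;t)=\int_G \frac{w(y;t)p_n(y;t)}{x-y}$. For $n\ge1$ set $$Y_n(x;t)=\begin{pmatrix}p_n & q_n/w\\ p_{n-1}& q_{n-1}/w\end{pmatrix}.$$ The spectral matrix $A_n^*$ is the matrix, polynomial in $x$, defined by $D_+(x;t)\,Y_n(qx;t)=A_n^*(x;t)\,Y_n(x;t)$; write $$A_n^*=\begin{pmatrix}\mathfrak W_{n,+}&-\mathfrak T_{n,+}\\ \mathfrak T_{n,-}&\mathfrak W_{n,-}\end{pmatrix}.$$ Put $b_5=b_1b_4b_6q^n$. Then $\mathfrak T_{n,+}$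 is $x$ times a polynomial of degree one in $x$, and $g_n=g_n(t)$ denotes the zero of that degree-one polynomial. The variable $f_n=f_n(t)$ is defined by $$\mathfrak W_{n,+}(g_n(t);t)=-\frac1t\,(g_n(t)-b_6t)(b_6g_n(t)-t)\,\big(f_n(q^{-1}t)\,g_n(t)-1\big).$$
   Formalization: The equation for C(t) is taken with right-hand side b_6qt/(g(b_5qt−f)) instead of b_6qt/(g(f−b_5qt)); with the printed sign the last term of the mixed equation has the wrong sign, so that equation fails. *)

theory Defs
  imports "HOL-Complex_Analysis.Complex_Analysis"
begin

text \<open>
  The parameters \<open>b\<^sub>1, \<dots>, b\<^sub>6\<close> are the values \<open>b 1, \<dots>, b 6\<close> of a function \<open>b\<close> on the naturals;
  the argument order for functions of the spectral variable \<open>x\<close> and the deformation variable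
  \<open>t\<close> is always \<open>x t\<close>.
\<close>

definition qpoch_inf :: "complex \<Rightarrow> complex \<Rightarrow> complex" where
  "qpoch_inf q a = (\<Prod>j. 1 - a * q ^ j)"

definition q_lattice :: "complex \<Rightarrow> complex \<Rightarrow> complex set" where
  "q_lattice q t0 = range (\<lambda>k::int. t0 * q powi k)"

text \<open>
  A family \<open>e s z\<close> of \<open>q\<close>-characters. Nice meromorphy normalises the value at a pole to be 0;
  the two functional equations map poles to poles for \<open>z \<noteq> 0\<close>, so requiring them pointwise is
  the same as requiring them as identities of meromorphic functions.
\<close>

definition q_character :: "complex \<Rightarrow> (complex \<Rightarrow> complex \<Rightarrow> complex) \<Rightarrow> bool" where
  "q_character q e \<longleftrightarrow>
     (\<forall>s. s \<noteq> 0 \<longrightarrow>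
        e s nicely_meromorphic_on (- {0}) \<and>
        (\<exists>z. z \<noteq> 0 \<and> e s z \<noteq> 0) \<and>
        (\<forall>z. z \<noteq> 0 \<longrightarrow> e s (q * z) = s * e s z \<and> e (q * s) z = z * e s z))"


definition weight :: "complex \<Rightarrow> (nat \<Rightarrow> complex) \<Rightarrow> complex \<Rightarrow> complex \<Rightarrow> complex" where
  "weight q b x t =
     (qpoch_inf q (b 2 * x) * qpoch_inf q (b 3 * x) * qpoch_inf q (inverse (b 6) * x * inverse t)) /
     (qpoch_inf q (b 1 * x) * qpoch_inf q (b 4 * x) * qpoch_inf q (b 6 * x * inverse t))"

text \<open>\<open>x\<close> is neither a zero nor a pole of the weight: no factor vanishes.\<close>

definition weight_regular :: "complex \<Rightarrow> (nat \<Rightarrow> complex) \<Rightarrow> complex \<Rightarrow> complex \<Rightarrow> bool" where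
  "weight_regular q b x t \<longleftrightarrow>
     qpoch_inf q (b 2 * x) \<noteq> 0 \<and> qpoch_inf q (b 3 * x) \<noteq> 0 \<and>
     qpoch_inf q (inverse (b 6) * x * inverse t) \<noteq> 0 \<and>
     qpoch_inf q (b 1 * x) \<noteq> 0 \<and> qpoch_inf q (b 4 * x) \<noteq> 0 \<and>
     qpoch_inf q (b 6 * x * inverse t) \<noteq> 0"

definition D_plus :: "(nat \<Rightarrow> complex) \<Rightarrow> complex \<Rightarrow> complex \<Rightarrow> complex" where
  "D_plus b x t = b 6 * (1 - b 1 * x) * (1 - b 4 * x) * (t - b 6 * x)"

definition D_minus :: "(nat \<Rightarrow> complex) \<Rightarrow> complex \<Rightarrow> complex \<Rightarrow> complex" where
  "D_minus b x t = (1 - b 2 * x) * (1 - b 3 * x) * (b 6 * t - x)"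

definition E_plus :: "complex \<Rightarrow> (nat \<Rightarrow> complex) \<Rightarrow> complex \<Rightarrow> complex \<Rightarrow> complex" where
  "E_plus q b x t = inverse (b 6) * (b 6 * q * t - x)"

definition E_minus :: "complex \<Rightarrow> (nat \<Rightarrow> complex) \<Rightarrow> complex \<Rightarrow> complex \<Rightarrow> complex" where
  "E_minus q b x t = q * t - b 6 * x"


text \<open>
  A Thomae--Jackson integral is given by a list \<open>G\<close> of pairs (coefficient, terminal), standing
  for the linear combination of the integrals from 0 to these terminals; the integral
  from \<open>a\<close> to \<open>c\<close> is \<open>G = [(1, c), (- 1, a)]\<close>.
\<close>

definition jackson0 :: "complex \<Rightarrow> complex \<Rightarrow> (complex \<Rightarrow> complex) \<Rightarrow> complex" where
  "jackson0 q a h = (1 - q) * a * (\<Sum>k. h (a * q ^ k) * q ^ k)"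

definition jackson :: "complex \<Rightarrow> (complex \<times> complex) list \<Rightarrow> (complex \<Rightarrow> complex) \<Rightarrow> complex" where
  "jackson q G h = (\<Sum>(c, a)\<leftarrow>G. c * jackson0 q a h)"

definition jackson_nodes :: "complex \<Rightarrow> (complex \<times> complex) list \<Rightarrow> complex set" where
  "jackson_nodes q G = {a * q ^ k | c a k. (c, a) \<in> set G}"

definition stieltjes ::
  "complex \<Rightarrow> (nat \<Rightarrow> complex) \<Rightarrow> (complex \<Rightarrow> (complex \<times> complex) list) \<Rightarrow>
   complex \<Rightarrow> complex \<Rightarrow> complex" where
  "stieltjes q b G x t = jackson q (G t) (\<lambda>y. weight q b y t / (x - y))"

text \<open>
  The two difference equations of the Stieltjes function. They express that the boundary
  terms vanish at the terminals of \<open>G t\<close>. Both sides are analytic in \<open>x\<close> away from 0 and the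
  nodes, where \<open>x - y\<close> would vanish, so the equations are imposed only there.
\<close>

definition stieltjes_spectral_eq ::
  "complex \<Rightarrow> (nat \<Rightarrow> complex) \<Rightarrow> (complex \<Rightarrow> (complex \<times> complex) list) \<Rightarrow> complex \<Rightarrow> bool" where
  "stieltjes_spectral_eq q b G t \<longleftrightarrow>
     (\<exists>U :: complex poly. \<forall>x. x \<noteq> 0 \<and> x \<notin> jackson_nodes q (G t) \<and> q * x \<notin> jackson_nodes q (G t) \<longrightarrow>
        D_minus b x t * stieltjes q b G (q * x) t =
        D_plus b x t * stieltjes q b G x t + (q - 1) * x * poly U x)"

definition stieltjes_deformation_eq ::
  "complex \<Rightarrow> (nat \<Rightarrow> complex) \<Rightarrow> (complex \<Rightarrow> (complex \<times> complex) list) \<Rightarrow> complex \<Rightarrow> bool" where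
  "stieltjes_deformation_eq q b G t \<longleftrightarrow>
     (\<exists>T :: complex poly.
        \<forall>x. x \<noteq> 0 \<and> x \<notin> jackson_nodes q (G t) \<and> x \<notin> jackson_nodes q (G (q * t)) \<longrightarrow>
        E_minus q b x t * stieltjes q b G x (q * t) =
        E_plus q b x t * stieltjes q b G x t + (q - 1) * t * poly T x)"

text \<open>\<open>p n t\<close> is the \<open>n\<close>-th orthonormal polynomial in \<open>x\<close>. The pairing is bilinear, so each
  \<open>p n t\<close> is determined up to a sign.\<close>

definition orthonormal_polys ::
  "complex \<Rightarrow> (nat \<Rightarrow> complex) \<Rightarrow> (complex \<Rightarrow> (complex \<times> complex) list) \<Rightarrow>
   (nat \<Rightarrow> complex \<Rightarrow> complex poly) \<Rightarrow> complex \<Rightarrow> bool" where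
  "orthonormal_polys q b G p t \<longleftrightarrow>
     (\<forall>n. degree (p n t) = n \<and> lead_coeff (p n t) \<noteq> 0) \<and>
     (\<forall>n m. jackson q (G t) (\<lambda>x. weight q b x t * poly (p n t) x * poly (p m t) x) =
        (if n = m then 1 else 0))"

definition second_kind ::
  "complex \<Rightarrow> (nat \<Rightarrow> complex) \<Rightarrow> (complex \<Rightarrow> (complex \<times> complex) list) \<Rightarrow>
   (nat \<Rightarrow> complex \<Rightarrow> complex poly) \<Rightarrow> nat \<Rightarrow> complex \<Rightarrow> complex \<Rightarrow> complex" where
  "second_kind q b G p n x t =
     jackson q (G t) (\<lambda>y. weight q b y t * poly (p n t) y / (x - y))"

definition Y_mat ::
  "complex \<Rightarrow> (nat \<Rightarrow> complex) \<Rightarrow> (complex \<Rightarrow> (complex \<times> complex) list) \<Rightarrow>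
   (nat \<Rightarrow> complex \<Rightarrow> complex poly) \<Rightarrow> nat \<Rightarrow> complex \<Rightarrow> complex \<Rightarrow> complex^2^2" where
  "Y_mat q b G p n x t =
     vector [vector [poly (p n t) x,       second_kind q b G p n x t / weight q b x t],
             vector [poly (p (n - 1) t) x, second_kind q b G p (n - 1) x t / weight q b x t]]"

text \<open>The matrix \<open>A\<close>, polynomial in \<open>x\<close>, satisfies \<open>D\<^sub>+(x;t) Y\<^sub>n(qx;t) = A(x) Y\<^sub>n(x;t)\<close>
  wherever \<open>Y\<^sub>n(x;t)\<close> and \<open>Y\<^sub>n(qx;t)\<close> have no singularity. The excluded set is
  countable, so this determines \<open>A\<close>.\<close>

definition spectral_matrix ::
  "complex \<Rightarrow> (nat \<Rightarrow> complex) \<Rightarrow> (complex \<Rightarrow> (complex \<times> complex) list) \<Rightarrow>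
   (nat \<Rightarrow> complex \<Rightarrow> complex poly) \<Rightarrow> nat \<Rightarrow> complex \<Rightarrow> complex poly^2^2 \<Rightarrow> bool" where
  "spectral_matrix q b G p n t A \<longleftrightarrow>
     (\<forall>x. x \<noteq> 0 \<and> x \<notin> jackson_nodes q (G t) \<and> q * x \<notin> jackson_nodes q (G t) \<and>
          weight_regular q b x t \<and> weight_regular q b (q * x) t \<longrightarrow>
        mat (D_plus b x t) ** Y_mat q b G p n (q * x) t =
        (\<chi> i j. poly (A $ i $ j) x) ** Y_mat q b G p n x t)"


text \<open>
  The gauge factor \<open>F(x,t)\<close>, and the points that are neither zeros nor poles of it. With the
  conventions above, the factor \<open>C\<close> that makes the mixed equation hold satisfies
  \<open>\<gamma>\<^sub>n(qt) C(qt) / (\<gamma>\<^sub>n(t) C(t)) = b\<^sub>6 q t / (g (b\<^sub>5 q t - f))\<close>. The opposite sign, with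
  denominator \<open>g (f - b\<^sub>5 q t)\<close>, would reverse the sign of the last term of the mixed equation.
\<close>

definition gauge ::
  "complex \<Rightarrow> (nat \<Rightarrow> complex) \<Rightarrow> (complex \<Rightarrow> complex \<Rightarrow> complex) \<Rightarrow> (complex \<Rightarrow> complex) \<Rightarrow>
   complex \<Rightarrow> complex \<Rightarrow> complex" where
  "gauge q b e C x t =
     e (t powi (- 2)) x * (qpoch_inf q (b 6 * x * inverse t) /
       (qpoch_inf q (b 2 * x) * qpoch_inf q (b 3 * x))) * C t"

definition gauge_regular ::
  "complex \<Rightarrow> (nat \<Rightarrow> complex) \<Rightarrow> (complex \<Rightarrow> complex \<Rightarrow> complex) \<Rightarrow> complex \<Rightarrow> complex \<Rightarrow> bool" where
  "gauge_regular q b e x t \<longleftrightarrow>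
     e (t powi (- 2)) x \<noteq> 0 \<and> qpoch_inf q (b 6 * x * inverse t) \<noteq> 0 \<and>
     qpoch_inf q (b 2 * x) \<noteq> 0 \<and> qpoch_inf q (b 3 * x) \<noteq> 0"


text \<open>The linear equations for an unknown \<open>U\<close> at the point \<open>(x, t)\<close>; here \<open>f\<close> and \<open>g\<close> are the
  values \<open>f\<^sub>n(t)\<close> and \<open>g\<^sub>n(t)\<close>.\<close>

definition mixed_eq ::
  "complex \<Rightarrow> complex \<Rightarrow> complex \<Rightarrow> (complex \<Rightarrow> complex \<Rightarrow> complex) \<Rightarrow> complex \<Rightarrow> complex \<Rightarrow> bool" where
  "mixed_eq q f g U x t \<longleftrightarrow>
     t^2 * U x t - (1 - f * x) * U (q * x) t - (x - g) / (q * g * x) * U (q * x) (q * t) = 0"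

definition second_order_eq ::
  "complex \<Rightarrow> (nat \<Rightarrow> complex) \<Rightarrow> complex \<Rightarrow> complex \<Rightarrow> (complex \<Rightarrow> complex \<Rightarrow> complex) \<Rightarrow>
   complex \<Rightarrow> complex \<Rightarrow> bool" where
  "second_order_eq q b f g U x t \<longleftrightarrow>
     (\<Prod>j=1..4. 1 - b j * x) / (t^2 * x * (x - g)) * U (q * x) t
     + (- (\<Prod>j=1..4. 1 - b j * x) / (x * (x - g) * (1 - f * x))
        + x * (\<Prod>j=1..4. f - b j) / (f * (1 - f * g) * (1 - f * x))
        - x * (f - b 5 * q * t) * (b 5 * f - t) / (b 5 * q * t^2 * f)
        - (x - b 6 * q * t) * (b 6 * x - q * t) * (q - f * x) /
            (b 6 * q * t^2 * x * (x - q * g))) * U x t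
     + (x - b 6 * q * t) * (b 6 * x - q * t) / (b 6 * x * (x - q * g)) * U (x / q) t = 0"

text \<open>Yamada's (transformed) Lax pair for the \<open>E\<^sub>6\<close> \<open>q\<close>-Painleve system.\<close>

definition yamada_deformation_eq ::
  "complex \<Rightarrow> complex \<Rightarrow> complex \<Rightarrow> (complex \<Rightarrow> complex \<Rightarrow> complex) \<Rightarrow> complex \<Rightarrow> complex \<Rightarrow> bool" where
  "yamada_deformation_eq q f g Y z t \<longleftrightarrow>
     q * t^2 / (f * z) * Y (z / q) t - q * ((1 - f * z) / (f * z)) * Y z t
     - (z - g) / (f * g * z^2) * Y z (q * t) = 0"

definition yamada_spectral_eq ::
  "complex \<Rightarrow> (nat \<Rightarrow> complex) \<Rightarrow> complex \<Rightarrow> complex \<Rightarrow> (complex \<Rightarrow> complex \<Rightarrow> complex) \<Rightarrow>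
   complex \<Rightarrow> complex \<Rightarrow> bool" where
  "yamada_spectral_eq q b f g Y z t \<longleftrightarrow>
     (\<Prod>j=1..4. 1 - b j * z) / (t^2 * z * (z - g)) * Y z t
     + (- (\<Prod>j=1..4. 1 - b j * z) / (z * (z - g) * (1 - f * z))
        + z * (\<Prod>j=1..4. b j - f) / (f * (1 - f * g) * (1 - f * z))
        - z * (f - b 5 * q * t) * (b 5 * f - t) / (b 5 * q * t^2 * f)
        - (z - b 6 * q * t) * (b 6 * z - q * t) * (q - f * z) /
            (b 6 * q * t^2 * z * (z - q * g))) * Y (z / q) t
     + (z - b 6 * q * t) * (b 6 * z - q * t) / (b 6 * z * (z - q * g)) * Y (z / q^2) t = 0"

end

theory Submission
  imports Defs
begin

text \<open>
  Write \<open>p'\<close>, \<open>s'\<close> for the values at \<open>qt\<close> of the orthonormal polynomial \<open>p = p\<^sub>n\<close> and its second-kind function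
  \<open>s\<close>. The three columns \<open>(p, s / w)\<close> taken at \<open>(x, t)\<close>, \<open>(qx, t)\<close> and \<open>(qx, qt)\<close> live in a two-dimensional
  space, so they satisfy a linear relation whose coefficients are their mutual Casoratians. The equations for
  the Stieltjes function and the asymptotics \<open>s = O(x ^ (- n - 1))\<close> show that, up to explicit factors, these
  Casoratians are a constant \<open>pd\<close>, a polynomial \<open>H\<close> of degree at most one and \<open>Tp\<close>. Evaluating at the
  zero of \<open>Tp\<close> at \<open>qt\<close> identifies \<open>q t H(x)\<close> with \<open>pd (1 - f x)\<close>, and the leading coefficient of \<open>Tp\<close> is
  explicit, which gives the mixed equation. The second-order equation for \<open>p\<close> has the coefficient
  \<open>Wp(x) / Tp(x) + Wm(x/q) / Tp(x/q)\<close>. It is determined by its partial fractions: the residues follow from the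
  values at \<open>0\<close> and \<open>g\<close>, the linear term from the leading coefficients, and the constant term from the
  derivative at \<open>0\<close> of \<open>det A = D\<^sub>+ D\<^sub>-\<close>.
\<close>

subsection \<open>Infinite q-Pochhammer symbols and the weight\<close>

text \<open>The obstacle is that the second-kind functions exist only off the nodes, and
  \<open>s / w\<close> only at regular points of the weight. Writing \<open>s = p * phi - r\<close>
  with the associated polynomial \<open>r\<close> makes \<open>phi\<close> cancel from every
  Casoratian. Each Casoratian is then a polynomial, and an identity checked near one suitable point
  extends to all \<open>x\<close>, including 0 and the nodes. Degree one for \<open>H\<close> is not
  automatic: composing the spectral with the deformation shift leaves a factor
  \<open>t - b 6 * x\<close>. The weight factors in \<open>x / t\<close> are invariant under
  \<open>(x, t) -> (q x, q t)\<close>, so this factor should cancel. That it does rests on the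
  weight having the value 0 at the pole \<open>x = t / b 6\<close>, so that no mass sits there. That
  \<open>pd\<close> is nonzero is not assumed: it follows from the position of \<open>g\<close> and
  from the coprimality of \<open>p\<close> and \<open>r\<close>.\<close>

lemma convergent_prod_qpoch:
  fixes q a :: complex
  assumes "norm q < 1"
  shows "convergent_prod (\<lambda>j. 1 - a * q ^ j)"
proof (rule abs_convergent_prod_imp_convergent_prod, rule summable_imp_abs_convergent_prod)
  have "summable (\<lambda>j. norm a * norm q ^ j)"
    using assms by (intro summable_mult summable_geometric) auto
  thus "summable (\<lambda>i. norm (1 - a * q ^ i - 1))"
    by (simp add: norm_mult norm_power)
qed

lemma qpoch_inf_rec:
  assumes "norm q < 1"
  shows "qpoch_inf q a = (1 - a) * qpoch_inf q (q * a)"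
proof -
  have "(\<lambda>j. 1 - q * a * q ^ j) has_prod qpoch_inf q (q * a)"
    unfolding qpoch_inf_def using convergent_prod_qpoch[OF assms] by (rule convergent_prod_has_prod)
  hence "(\<lambda>j. 1 - a * q ^ Suc j) has_prod qpoch_inf q (q * a)"
    by (simp add: mult_ac)
  hence "(\<lambda>j. 1 - a * q ^ j) has_prod (qpoch_inf q (q * a) * (1 - a * q ^ 0))"
    by (rule has_prod_Suc_imp)
  thus ?thesis
    unfolding qpoch_inf_def[of q a] by (simp add: has_prod_iff mult.commute)
qed

lemma qpoch_inf_1: "norm q < 1 \<Longrightarrow> qpoch_inf q 1 = 0"
  by (subst qpoch_inf_rec) auto

text \<open>Besides the functional equation, what matters about the infinite product is its
  continuity at 0, since the nodes of a Jackson integral accumulate only there. Comparing partial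
  products with the exponential of a geometric series gives it.\<close>

lemma norm_qpoch_inf_minus_1_le:
  assumes "norm q < 1"
  shows "norm (qpoch_inf q a - 1) \<le> exp (norm a / (1 - norm q)) - 1"
proof -
  have "(\<lambda>n. \<Prod>j\<le>n. 1 - a * q ^ j) \<longlonglongrightarrow> qpoch_inf q a"
    unfolding qpoch_inf_def by (intro convergent_prod_LIMSEQ convergent_prod_qpoch assms)
  hence lim: "(\<lambda>n. norm ((\<Prod>j\<le>n. 1 - a * q ^ j) - 1)) \<longlonglongrightarrow> norm (qpoch_inf q a - 1)"
    by (intro tendsto_intros)
  show ?thesis
  proof (rule LIMSEQ_le_const2[OF lim], intro exI allI impI)
    fix n :: nat
    have "norm ((\<Prod>j\<le>n. 1 + (- a * q ^ j)) - 1) \<le> (\<Prod>j\<le>n. 1 + norm (- a * q ^ j)) - 1"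
      by (rule norm_prod_minus1_le_prod_minus1)
    also have "(\<Prod>j\<le>n. 1 + norm (- a * q ^ j)) \<le> exp (\<Sum>j\<le>n. norm (- a * q ^ j))"
      by (rule prod_le_exp_sum) auto
    also have "(\<Sum>j\<le>n. norm (- a * q ^ j)) = norm a * (\<Sum>j\<le>n. norm q ^ j)"
      by (simp add: norm_mult norm_power sum_distrib_left)
    also have "(\<Sum>j\<le>n. norm q ^ j) \<le> (\<Sum>j. norm q ^ j)"
      using assms by (intro sum_le_suminf summable_geometric) auto
    also have "\<dots> = 1 / (1 - norm q)"
      using assms by (simp add: suminf_geometric)
    finally show "norm ((\<Prod>j\<le>n. 1 - a * q ^ j) - 1) \<le> exp (norm a / (1 - norm q)) - 1"
      by (simp add: mult_left_mono)
  qed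
qed

lemma tendsto_qpoch_inf_0:
  assumes "norm q < 1"
  shows "(qpoch_inf q \<longlongrightarrow> 1) (nhds 0)"
proof -
  have "((\<lambda>a::complex. exp (norm a / (1 - norm q)) - 1) \<longlongrightarrow> exp (norm (0::complex) / (1 - norm q)) - 1) (nhds 0)"
    using assms by (intro tendsto_intros filterlim_ident) auto
  hence lim: "((\<lambda>a::complex. exp (norm a / (1 - norm q)) - 1) \<longlongrightarrow> 0) (nhds 0)"
    by simp
  have "((\<lambda>a. qpoch_inf q a - 1) \<longlongrightarrow> 0) (nhds 0)"
    using norm_qpoch_inf_minus_1_le[OF assms] by (intro Lim_null_comparison[OF _ lim]) simp
  thus ?thesis by (rule LIM_zero_cancel)
qed

lemma tendsto_qpoch_inf_mult_0:
  assumes "norm q < 1"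
  shows "((\<lambda>x. qpoch_inf q (c * x * d)) \<longlongrightarrow> 1) (nhds 0)"
proof (rule filterlim_compose[OF tendsto_qpoch_inf_0[OF assms]])
  have "((\<lambda>x. c * x * d) \<longlongrightarrow> c * 0 * d) (nhds 0)" by (intro tendsto_intros filterlim_ident)
  thus "((\<lambda>x. c * x * d) \<longlongrightarrow> 0) (nhds 0)" by simp
qed

lemma tendsto_weight_0:
  assumes "norm q < 1"
  shows "((\<lambda>x. weight q b x t) \<longlongrightarrow> 1) (nhds 0)"
proof -
  note T = tendsto_qpoch_inf_mult_0[OF assms]
  have "((\<lambda>x. weight q b x t) \<longlongrightarrow> (1 * 1 * 1) / (1 * 1 * 1)) (nhds 0)"
    unfolding weight_def using T[of _ 1] T by (intro tendsto_intros) auto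
  thus ?thesis by simp
qed

lemma eventually_weight_regular_0:
  assumes "norm q < 1"
  shows "eventually (\<lambda>x. weight_regular q b x t) (nhds 0)"
proof -
  have "eventually (\<lambda>x. qpoch_inf q (c * x * d) \<noteq> 0) (nhds 0)" for c d
    using tendsto_qpoch_inf_mult_0[OF assms, of c d] by (rule tendsto_imp_eventually_ne) auto
  note ev = this this[where d = 1, simplified]
  show ?thesis
    unfolding weight_regular_def by (intro eventually_conj ev)
qed

lemma weight_regular_nonzero: "weight_regular q b x t \<Longrightarrow> weight q b x t \<noteq> 0"
  by (simp add: weight_regular_def weight_def)

text \<open>The shift strips the zeroth factor off each of the six products. Pulling out
  \<open>b 6 * t\<close> exhibits \<open>D_plus\<close> and \<open>D_minus\<close> as the products
  of the stripped factors.\<close>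

lemma weight_shift_x:
  assumes "norm q < 1" and "weight_regular q b x t" and "weight_regular q b (q * x) t"
    and "b 6 \<noteq> 0" "t \<noteq> 0"
  shows "D_minus b x t * weight q b (q * x) t = D_plus b x t * weight q b x t"
proof -
  have r: "qpoch_inf q (c * x) = (1 - c * x) * qpoch_inf q (c * (q * x))"
          "qpoch_inf q (c * x * d) = (1 - c * x * d) * qpoch_inf q (c * (q * x) * d)" for c d
    using qpoch_inf_rec[OF assms(1), of "c * x"] qpoch_inf_rec[OF assms(1), of "c * x * d"]
    by (simp_all add: mult_ac)
  have nz: "1 - b 1 * x \<noteq> 0" "1 - b 4 * x \<noteq> 0" "1 - b 6 * x * inverse t \<noteq> 0"
    using assms(2) r unfolding weight_regular_def by auto
  have D: "D_plus b x t = b 6 * t * ((1 - b 1 * x) * (1 - b 4 * x) * (1 - b 6 * x * inverse t))"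
          "D_minus b x t = b 6 * t * ((1 - b 2 * x) * (1 - b 3 * x) * (1 - inverse (b 6) * x * inverse t))"
    using assms(4,5) by (auto simp: D_plus_def D_minus_def field_simps)
  \<comment> \<open>The infinite products \<open>c1, ..., c6\<close> stay opaque and may even
    vanish; only the stripped denominator factors have to be nonzero.\<close>
  have cancel: "k * (a2 * a3 * a6) * ((c2 * c3 * c6) / (c1 * c4 * c5)) =
      k * (a1 * a4 * a5) * (((a2 * c2) * (a3 * c3) * (a6 * c6)) / ((a1 * c1) * (a4 * c4) * (a5 * c5)))"
    if "a1 \<noteq> 0" "a4 \<noteq> 0" "a5 \<noteq> 0" for k a1 a2 a3 a4 a5 a6 c1 c2 c3 c4 c5 c6 :: complex
    using that by (simp add: divide_simps)
  show "D_minus b x t * weight q b (q * x) t = D_plus b x t * weight q b x t"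
    unfolding D weight_def
    unfolding r(1)[of "b 1"] r(1)[of "b 2"] r(1)[of "b 3"] r(1)[of "b 4"] r(2)
    using nz by (rule cancel)
qed

subsection \<open>Jackson integrals as bounded functionals\<close>

lemma bounded_image_mult:
  fixes f g :: "'a \<Rightarrow> complex"
  assumes "bounded (f ` N)" "bounded (g ` N)"
  shows "bounded ((\<lambda>y. f y * g y) ` N)"
proof -
  obtain A B where A: "\<forall>y\<in>N. norm (f y) \<le> A" and B: "\<forall>y\<in>N. norm (g y) \<le> B"
    using assms unfolding bounded_iff by auto
  have "norm (f y * g y) \<le> A * B" if "y \<in> N" for y
  proof -
    have "norm (f y) \<le> A" "norm (g y) \<le> B" using A B that by auto
    thus ?thesis by (simp add: norm_mult mult_mono')
  qed
  thus ?thesis unfolding bounded_iff by blast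
qed

lemma bounded_image_add:
  fixes f g :: "'a \<Rightarrow> complex"
  assumes "bounded (f ` N)" "bounded (g ` N)"
  shows "bounded ((\<lambda>y. f y + g y) ` N)"
  using assms by (rule bounded_plus_comp)

lemma bounded_image_const: "bounded ((\<lambda>y. c :: complex) ` N)"
  unfolding bounded_iff by auto

lemma bounded_image_poly:
  assumes "bounded N"
  shows "bounded (poly (P :: complex poly) ` N)"
proof (induction P)
  case (pCons a P)
  have "bounded ((\<lambda>y. y) ` N)" using assms by simp
  hence "bounded ((\<lambda>y. a + y * poly P y) ` N)"
    by (intro bounded_image_add bounded_image_mult bounded_image_const pCons.IH)
  thus ?case by simp
qed (auto simp: bounded_iff)

section \<open>The nodes and their accumulation at 0\<close>

lemma jackson_nodes_eq: "jackson_nodes q G = (\<Union>(c, a)\<in>set G. range (\<lambda>k. a * q ^ k))"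
  by (auto simp: jackson_nodes_def)

lemma node_tendsto_0:
  fixes q a :: complex
  assumes "norm q < 1"
  shows "(\<lambda>k. a * q ^ k) \<longlonglongrightarrow> 0"
  using tendsto_mult_right_zero[OF LIMSEQ_power_zero[OF assms], of a] by simp

text \<open>Along each terminal the nodes tend to 0, and convergent sequences are bounded, whatever
  the values at the first few nodes. The limit is along \<open>nhds 0\<close>, not
  \<open>at 0\<close>, because a terminal 0 makes 0 itself a node.\<close>

lemma bounded_image_nodes:
  fixes h :: "complex \<Rightarrow> complex"
  assumes "norm q < 1" and "(h \<longlongrightarrow> l) (nhds 0)"
  shows "bounded (h ` jackson_nodes q G)"
proof -
  have "bounded (range (\<lambda>k. h (a * q ^ k)))" for a
  proof -
    have "(\<lambda>k. h (a * q ^ k)) \<longlonglongrightarrow> l"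
      using filterlim_compose[OF assms(2) node_tendsto_0[OF assms(1)]] .
    thus ?thesis by (rule convergent_imp_bounded)
  qed
  moreover have "h ` jackson_nodes q G = (\<Union>(c, a)\<in>set G. range (\<lambda>k. h (a * q ^ k)))"
    unfolding jackson_nodes_eq by auto
  ultimately show ?thesis by auto
qed

lemma bounded_jackson_nodes: "norm q < 1 \<Longrightarrow> bounded (jackson_nodes q G)"
  using bounded_image_nodes[of q "\<lambda>x. x" 0 G] filterlim_ident[of "nhds 0"] by simp

text \<open>Boundedness of \<open>1 / (z - y)\<close> on the nodes in another form. The patch at
  \<open>y = z\<close> admits a \<open>z\<close> that is itself a node, as can happen at a pole of
  the weight.\<close>

lemma jackson_nodes_separated:
  assumes "norm q < 1" and "z \<noteq> 0"
  obtains d where "d > 0" "\<And>y. y \<in> jackson_nodes q G \<Longrightarrow> y \<noteq> z \<Longrightarrow> d \<le> norm (z - y)"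
proof -
  have "bounded ((\<lambda>y. if y = z then 0 else inverse (z - y)) ` jackson_nodes q G)"
  proof (rule bounded_image_nodes[OF assms(1)])
    have "((\<lambda>y. inverse (z - y)) \<longlongrightarrow> inverse (z - 0)) (nhds 0)"
      using assms(2) by (intro tendsto_intros filterlim_ident) auto
    moreover have "eventually (\<lambda>y. y \<noteq> z) (nhds 0)"
      using assms(2) by (metis t1_space_nhds)
    hence "eventually (\<lambda>y. inverse (z - y) = (if y = z then 0 else inverse (z - y))) (nhds 0)"
      by eventually_elim auto
    ultimately show "((\<lambda>y. if y = z then 0 else inverse (z - y)) \<longlongrightarrow> inverse (z - 0)) (nhds 0)"
      by (rule Lim_transform_eventually)
  qed
  then obtain M where M: "M > 0" "\<And>y. y \<in> jackson_nodes q G \<Longrightarrow> norm (if y = z then 0 else inverse (z - y)) \<le> M"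
    unfolding bounded_pos by auto
  show ?thesis
  proof
    show "inverse M > 0" using M by simp
    fix y assume "y \<in> jackson_nodes q G" "y \<noteq> z"
    hence "inverse (norm (z - y)) \<le> M" using M(2)[of y] by (simp add: norm_inverse)
    thus "inverse M \<le> norm (z - y)"
      using \<open>y \<noteq> z\<close> by (metis inverse_inverse_eq le_imp_inverse_le positive_imp_inverse_positive right_minus_eq zero_less_norm_iff)
  qed
qed

lemma eventually_not_node_at:
  assumes "norm q < 1" and "z \<noteq> 0"
  shows "eventually (\<lambda>x. x \<noteq> 0 \<and> x \<notin> jackson_nodes q G) (at z)"
proof -
  obtain d where d: "d > 0" "\<And>y. y \<in> jackson_nodes q G \<Longrightarrow> y \<noteq> z \<Longrightarrow> d \<le> norm (z - y)"
    using jackson_nodes_separated[OF assms, of G] by blast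
  have "eventually (\<lambda>x. x \<noteq> z \<and> dist x z < min d (norm z)) (at z)"
    using d(1) assms(2) by (auto simp: eventually_at intro!: exI[of _ "min d (norm z)"])
  thus ?thesis
  proof eventually_elim
    case (elim x)
    thus ?case using d(2)[of x] by (auto simp: dist_norm norm_minus_commute)
  qed
qed

lemma eventually_not_node_at_infinity:
  assumes "norm q < 1"
  shows "eventually (\<lambda>x. x \<noteq> 0 \<and> x \<notin> jackson_nodes q G) at_infinity"
proof -
  obtain M where M: "M > 0" "\<And>y. y \<in> jackson_nodes q G \<Longrightarrow> norm y \<le> M"
    using bounded_jackson_nodes[OF assms, of G] unfolding bounded_pos by auto
  have "x \<noteq> 0 \<and> x \<notin> jackson_nodes q G" if "norm x \<ge> M + 1" for x
    using M that by force
  thus ?thesis unfolding eventually_at_infinity by blast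
qed

section \<open>Linearity and continuity of the Jackson integral\<close>

lemma summable_jackson:
  assumes "norm q < 1" "bounded (h ` jackson_nodes q G)" "(c, a) \<in> set G"
  shows "summable (\<lambda>k. h (a * q ^ k) * q ^ k)"
proof -
  obtain M where M: "\<forall>y\<in>jackson_nodes q G. norm (h y) \<le> M"
    using assms(2) unfolding bounded_iff by auto
  show ?thesis
  proof (rule summable_comparison_test')
    show "summable (\<lambda>k. M * norm q ^ k)"
      using assms(1) by (intro summable_mult summable_geometric) auto
    fix k
    have "norm (h (a * q ^ k)) \<le> M" using M assms(3) unfolding jackson_nodes_eq by auto
    thus "norm (h (a * q ^ k) * q ^ k) \<le> M * norm q ^ k"
      by (simp add: norm_mult norm_power mult_right_mono)
  qed
qed

lemma jackson_add:
  assumes "norm q < 1" "bounded (h1 ` jackson_nodes q G)" "bounded (h2 ` jackson_nodes q G)"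
  shows "jackson q G (\<lambda>y. h1 y + h2 y) = jackson q G h1 + jackson q G h2"
proof -
  have "c * jackson0 q a (\<lambda>y. h1 y + h2 y) = c * jackson0 q a h1 + c * jackson0 q a h2"
    if "(c, a) \<in> set G" for c a
  proof -
    have "(\<Sum>k. (h1 (a * q ^ k) + h2 (a * q ^ k)) * q ^ k) =
        (\<Sum>k. h1 (a * q ^ k) * q ^ k) + (\<Sum>k. h2 (a * q ^ k) * q ^ k)"
      using suminf_add[OF summable_jackson[OF assms(1,2) that] summable_jackson[OF assms(1,3) that]]
      by (simp add: distrib_right)
    thus ?thesis by (simp add: jackson0_def distrib_left)
  qed
  hence "map (\<lambda>(c, a). c * jackson0 q a (\<lambda>y. h1 y + h2 y)) G =
         map (\<lambda>p. (\<lambda>(c, a). c * jackson0 q a h1) p + (\<lambda>(c, a). c * jackson0 q a h2) p) G"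
    by (intro map_cong refl) (auto simp only: split_beta fst_conv snd_conv)
  thus ?thesis unfolding jackson_def by (simp only: sum_list_addf)
qed

lemma jackson_cmult:
  assumes "norm q < 1" "bounded (h ` jackson_nodes q G)"
  shows "jackson q G (\<lambda>y. k * h y) = k * jackson q G h"
proof -
  have "c * jackson0 q a (\<lambda>y. k * h y) = k * (c * jackson0 q a h)"
    if "(c, a) \<in> set G" for c a
    using suminf_mult[OF summable_jackson[OF assms that], of k]
    by (simp add: jackson0_def mult_ac)
  hence "map (\<lambda>(c, a). c * jackson0 q a (\<lambda>y. k * h y)) G =
         map (\<lambda>p. k * (\<lambda>(c, a). c * jackson0 q a h) p) G"
    by (intro map_cong refl) (auto simp only: split_beta fst_conv snd_conv)
  thus ?thesis unfolding jackson_def by (simp only: sum_list_const_mult)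
qed

lemma jackson_zero: "jackson q G (\<lambda>y. 0) = 0"
  by (induction G) (auto simp: jackson_def jackson0_def)

lemma jackson_cong:
  assumes "\<And>y. y \<in> jackson_nodes q G \<Longrightarrow> h1 y = h2 y"
  shows "jackson q G h1 = jackson q G h2"
proof -
  have "c * jackson0 q a h1 = c * jackson0 q a h2" if "(c, a) \<in> set G" for c a
  proof -
    have "h1 (a * q ^ k) = h2 (a * q ^ k)" for k
      using that by (intro assms) (auto simp: jackson_nodes_eq)
    thus ?thesis by (simp add: jackson0_def)
  qed
  hence "map (\<lambda>(c, a). c * jackson0 q a h1) G = map (\<lambda>(c, a). c * jackson0 q a h2) G"
    by (intro map_cong refl) (auto simp only: split_beta fst_conv snd_conv)
  thus ?thesis by (simp only: jackson_def)
qed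

text \<open>\<open>K\<close> is independent of the integrand, so the Jackson integral is continuous
  for the supremum norm on the nodes, and uniform bounds on Cauchy kernels pass to the
  transforms.\<close>

lemma norm_jackson_le:
  assumes "norm q < 1"
  obtains K where "K \<ge> 0"
    "\<And>h M. (\<And>y. y \<in> jackson_nodes q G \<Longrightarrow> norm (h y) \<le> M) \<Longrightarrow> 0 \<le> M \<Longrightarrow> norm (jackson q G h) \<le> K * M"
proof
  let ?K = "\<Sum>(c, a)\<leftarrow>G. norm (c * ((1 - q) * a)) * (1 / (1 - norm q))"
  show "?K \<ge> 0" using assms by (intro sum_list_nonneg) auto
  fix h :: "complex \<Rightarrow> complex" and M :: real
  assume M: "\<And>y. y \<in> jackson_nodes q G \<Longrightarrow> norm (h y) \<le> M" and M0: "0 \<le> M"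
  have *: "norm (c * jackson0 q a h) \<le> norm (c * ((1 - q) * a)) * (1 / (1 - norm q)) * M"
    if ca: "(c, a) \<in> set G" for c a
  proof -
    have le: "norm (h (a * q ^ k) * q ^ k) \<le> M * norm q ^ k" for k
    proof -
      have "norm (h (a * q ^ k)) \<le> M" using ca by (intro M) (auto simp: jackson_nodes_eq)
      thus ?thesis by (simp add: norm_mult norm_power mult_right_mono)
    qed
    have sm: "summable (\<lambda>k. M * norm q ^ k)"
      using assms by (intro summable_mult summable_geometric) auto
    have "norm (\<Sum>k. h (a * q ^ k) * q ^ k) \<le> (\<Sum>k. M * norm q ^ k)"
      using norm_suminf_le[OF le sm] .
    also have "\<dots> = M * (1 / (1 - norm q))"
      using assms by (subst suminf_mult) (auto simp: suminf_geometric summable_geometric)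
    finally have "norm (c * ((1 - q) * a)) * norm (\<Sum>k. h (a * q ^ k) * q ^ k) \<le>
        norm (c * ((1 - q) * a)) * (M * (1 / (1 - norm q)))"
      by (rule mult_left_mono) auto
    thus ?thesis by (simp add: jackson0_def norm_mult mult_ac)
  qed
  have "norm (jackson q G h) \<le> (\<Sum>p\<leftarrow>G. norm ((\<lambda>(c, a). c * jackson0 q a h) p))"
    unfolding jackson_def by (induction G) (auto intro: order.trans[OF norm_triangle_ineq])
  also have "\<dots> \<le> (\<Sum>p\<leftarrow>G. (\<lambda>(c, a). norm (c * ((1 - q) * a)) * (1 / (1 - norm q))) p * M)"
    using * by (intro sum_list_mono) auto
  also have "\<dots> = ?K * M"
    by (simp only: sum_list_mult_const)
  finally show "norm (jackson q G h) \<le> ?K * M" .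
qed

subsection \<open>Polynomial functions\<close>

text \<open>The identities below mix polynomials at \<open>x\<close> and \<open>q * x\<close> with
  explicit factors. A predicate with closure rules shows both sides to be polynomial without
  constructing them.\<close>

definition polyfun :: "(complex \<Rightarrow> complex) \<Rightarrow> bool" where
  "polyfun F \<longleftrightarrow> (\<exists>P. \<forall>x. F x = poly P x)"

lemma polyfun_poly: "polyfun (\<lambda>x. poly P x)"
  unfolding polyfun_def by blast

lemma polyfun_const: "polyfun (\<lambda>x. c)"
  unfolding polyfun_def by (intro exI[of _ "[:c:]"]) auto

lemma polyfun_ident: "polyfun (\<lambda>x. x)"
  unfolding polyfun_def by (intro exI[of _ "[:0, 1:]"]) auto

lemma polyfun_add: "polyfun F \<Longrightarrow> polyfun H \<Longrightarrow> polyfun (\<lambda>x. F x + H x)"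
  unfolding polyfun_def by (metis poly_add)

lemma polyfun_mult: "polyfun F \<Longrightarrow> polyfun H \<Longrightarrow> polyfun (\<lambda>x. F x * H x)"
  unfolding polyfun_def by (metis poly_mult)

lemma polyfun_diff: "polyfun F \<Longrightarrow> polyfun H \<Longrightarrow> polyfun (\<lambda>x. F x - H x)"
  unfolding polyfun_def by (metis poly_diff)

lemma polyfun_minus: "polyfun F \<Longrightarrow> polyfun (\<lambda>x. - F x)"
  unfolding polyfun_def by (metis poly_minus)

lemma polyfun_comp: "polyfun F \<Longrightarrow> polyfun H \<Longrightarrow> polyfun (\<lambda>x. F (H x))"
  unfolding polyfun_def by (metis poly_pcompose)

lemma polyfun_poly_comp: "polyfun H \<Longrightarrow> polyfun (\<lambda>x. poly P (H x))"
  using polyfun_comp[OF polyfun_poly] .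

lemmas polyfun_intros = polyfun_const polyfun_ident polyfun_poly polyfun_add polyfun_mult
  polyfun_diff polyfun_minus polyfun_poly_comp

lemma polyfun_eq_0:
  assumes "polyfun F" "infinite {x. F x = 0}"
  shows "F x = 0"
proof -
  obtain P where P: "\<And>x. F x = poly P x" using assms(1) unfolding polyfun_def by auto
  have "P = 0" using assms(2) poly_roots_finite[of P] unfolding P by auto
  thus ?thesis using P by simp
qed

text \<open>\<open>z\<close> is a limit point of the zeros of the difference, which therefore has
  infinitely many roots. This carries identities across the nodes, where Cauchy transforms are not
  controlled.\<close>

lemma polyfun_eq_at:
  assumes "polyfun F" "polyfun H" "eventually (\<lambda>x. F x = H x) (at z)"
  shows "\<forall>x. F x = H x"
proof -
  have "z islimpt {x. F x - H x = 0}"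
    unfolding islimpt_iff_eventually
  proof
    assume "eventually (\<lambda>y. y \<notin> {x. F x - H x = 0}) (at z)"
    with assms(3) have "eventually (\<lambda>_. False) (at z)"
      by eventually_elim simp
    thus False by simp
  qed
  hence "infinite {x. F x - H x = 0}" using islimpt_finite by blast
  thus ?thesis using polyfun_eq_0[OF polyfun_diff[OF assms(1,2)]] by auto
qed

lemma tendsto_inverse_power_at_infinity:
  "m > 0 \<Longrightarrow> ((\<lambda>x::complex. 1 / x ^ m) \<longlongrightarrow> 0) at_infinity"
  by (rule tendsto_divide_0[OF tendsto_const]) (auto intro: filterlim_power_at_infinity)

text \<open>Divided by the power of its own degree, a polynomial tends to its leading coefficient;
  comparing the two exponents gives the bound. \<open>L = 0\<close> is allowed, so the degree may be
  smaller than \<open>k\<close>.\<close>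

lemma polyfun_tendsto_coeff:
  assumes "polyfun F" "((\<lambda>x. F x / x ^ k) \<longlongrightarrow> L) at_infinity"
  shows "\<exists>P. degree P \<le> k \<and> coeff P k = L \<and> (\<forall>x. F x = poly P x)"
proof -
  obtain P where P: "\<And>x. F x = poly P x" using assms(1) unfolding polyfun_def by auto
  define d where "d = degree P"
  have lc: "((\<lambda>x. F x / x ^ d) \<longlongrightarrow> lead_coeff P) at_infinity"
    unfolding P d_def by (rule poly_divide_tendsto_aux)
  have nz: "eventually (\<lambda>x::complex. x \<noteq> 0) at_infinity"
    by (auto simp: eventually_at_infinity intro: exI[of _ 1])
  have "d \<le> k"
  proof (rule ccontr)
    assume "\<not> d \<le> k"
    have "((\<lambda>x. F x / x ^ k * (1 / x ^ (d - k))) \<longlongrightarrow> L * 0) at_infinity"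
      using \<open>\<not> d \<le> k\<close> by (intro tendsto_mult assms(2) tendsto_inverse_power_at_infinity) auto
    moreover have "eventually (\<lambda>x. F x / x ^ k * (1 / x ^ (d - k)) = F x / x ^ d) at_infinity"
      using nz by eventually_elim (use \<open>\<not> d \<le> k\<close> in \<open>simp add: power_add[symmetric]\<close>)
    ultimately have "((\<lambda>x. F x / x ^ d) \<longlongrightarrow> L * 0) at_infinity"
      by (rule Lim_transform_eventually)
    hence "lead_coeff P = L * 0"
      using lc tendsto_unique[of "at_infinity :: complex filter"] by (metis trivial_limit_at_infinity)
    thus False using \<open>\<not> d \<le> k\<close> by (auto simp: d_def)
  qed
  moreover have "coeff P k = L"
  proof (cases "d = k")
    case True
    thus ?thesis
      using lc assms(2) tendsto_unique[of "at_infinity :: complex filter"] unfolding d_def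
      by (metis trivial_limit_at_infinity)
  next
    case False
    hence "d < k" using \<open>d \<le> k\<close> by simp
    have "((\<lambda>x. F x / x ^ d * (1 / x ^ (k - d))) \<longlongrightarrow> lead_coeff P * 0) at_infinity"
      using \<open>d < k\<close> by (intro tendsto_mult lc tendsto_inverse_power_at_infinity) auto
    moreover have "eventually (\<lambda>x. F x / x ^ d * (1 / x ^ (k - d)) = F x / x ^ k) at_infinity"
      using nz by eventually_elim (use \<open>d < k\<close> in \<open>simp add: power_add[symmetric]\<close>)
    ultimately have "((\<lambda>x. F x / x ^ k) \<longlongrightarrow> lead_coeff P * 0) at_infinity"
      by (rule Lim_transform_eventually)
    hence "L = lead_coeff P * 0"
      using assms(2) tendsto_unique[of "at_infinity :: complex filter"] by (metis trivial_limit_at_infinity)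
    thus ?thesis using \<open>d < k\<close> by (simp add: coeff_eq_0 d_def)
  qed
  ultimately show ?thesis using P unfolding d_def by blast
qed

subsection \<open>Cauchy transforms and orthonormal polynomials\<close>

locale jackson_weight =
  fixes q :: complex and G :: "(complex \<times> complex) list" and w :: "complex \<Rightarrow> complex"
  assumes q_less: "norm q < 1"
    and bounded_weight: "bounded (w ` jackson_nodes q G)"
begin

abbreviation nodes where "nodes \<equiv> jackson_nodes q G"

definition cauchy where "cauchy h x = jackson q G (\<lambda>y. w y * h y / (x - y))"

lemma bounded_cauchy_kernel:
  assumes "x \<noteq> 0" "x \<notin> nodes"
  shows "bounded ((\<lambda>y. 1 / (x - y)) ` nodes)"
proof -
  obtain d where d: "d > 0" "\<And>y. y \<in> nodes \<Longrightarrow> y \<noteq> x \<Longrightarrow> d \<le> norm (x - y)"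
    using jackson_nodes_separated[OF q_less assms(1), of G] by blast
  have "norm (1 / (x - y)) \<le> 1 / d" if "y \<in> nodes" for y
    using d(1) d(2)[OF that] assms(2) that by (auto simp: norm_divide intro!: divide_left_mono mult_pos_pos)
  thus ?thesis unfolding bounded_iff by blast
qed

lemma bounded_cauchy:
  assumes "x \<noteq> 0" "x \<notin> nodes" "bounded (h ` nodes)"
  shows "bounded ((\<lambda>y. w y * h y / (x - y)) ` nodes)"
  using bounded_image_mult[OF bounded_image_mult[OF bounded_weight assms(3)] bounded_cauchy_kernel[OF assms(1,2)]]
  by simp

lemma bounded_poly: "bounded (poly P ` nodes)"
  by (intro bounded_image_poly bounded_jackson_nodes q_less)

text \<open>This is \<open>x / (x - y) = 1 + y / (x - y)\<close> under the integral. It drives both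
  the associated polynomials and the expansion at infinity.\<close>

lemma cauchy_shift:
  assumes "x \<noteq> 0" "x \<notin> nodes" "bounded (h ` nodes)"
  shows "x * cauchy h x = jackson q G (\<lambda>y. w y * h y) + cauchy (\<lambda>y. y * h y) x"
proof -
  have b: "bounded ((\<lambda>y. y * h y) ` nodes)"
    using bounded_image_mult[of "\<lambda>y. y", OF _ assms(3)] bounded_jackson_nodes[OF q_less] by simp
  have "x * cauchy h x = jackson q G (\<lambda>y. x * (w y * h y / (x - y)))"
    unfolding cauchy_def by (rule jackson_cmult[OF q_less bounded_cauchy[OF assms], symmetric])
  also have "\<dots> = jackson q G (\<lambda>y. w y * h y + w y * (y * h y) / (x - y))"
  proof (rule jackson_cong)
    fix y assume "y \<in> nodes"
    hence "x - y \<noteq> 0" using assms(2) by auto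
    thus "x * (w y * h y / (x - y)) = w y * h y + w y * (y * h y) / (x - y)"
      by (simp add: divide_simps) (simp add: algebra_simps)
  qed
  also have "\<dots> = jackson q G (\<lambda>y. w y * h y) + cauchy (\<lambda>y. y * h y) x"
    unfolding cauchy_def
    by (intro jackson_add q_less bounded_image_mult bounded_weight assms(3) bounded_cauchy[OF assms(1,2) b])
  finally show ?thesis .
qed

text \<open>The quotient \<open>(P(x) - P(y)) / (x - y)\<close> is a polynomial in \<open>x\<close>.
  The induction is Horner's scheme, with \<open>cauchy_shift\<close> accounting for the
  multiplication by \<open>y\<close>.\<close>

lemma ex_associated_poly:
  "\<exists>R. \<forall>x. x \<noteq> 0 \<and> x \<notin> nodes \<longrightarrow> poly P x * cauchy (\<lambda>_. 1) x - cauchy (poly P) x = poly R x"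
proof (induction P)
  case 0
  show ?case by (rule exI[of _ 0]) (simp add: cauchy_def jackson_zero)
next
  case (pCons a P)
  then obtain R where R: "\<And>x. x \<noteq> 0 \<Longrightarrow> x \<notin> nodes \<Longrightarrow> poly P x * cauchy (\<lambda>_. 1) x - cauchy (poly P) x = poly R x"
    by blast
  have "poly (pCons a P) x * cauchy (\<lambda>_. 1) x - cauchy (poly (pCons a P)) x =
      poly (pCons (jackson q G (\<lambda>y. w y * poly P y)) R) x" if x: "x \<noteq> 0" "x \<notin> nodes" for x
  proof -
    have b: "bounded ((\<lambda>y. y * poly P y) ` nodes)"
      using bounded_poly[of "[:0, 1:] * P"] by simp
    have "cauchy (poly (pCons a P)) x = jackson q G (\<lambda>y. a * (w y * 1 / (x - y)) + w y * (y * poly P y) / (x - y))"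
      unfolding cauchy_def by (intro jackson_cong) (simp add: ring_distribs add_divide_distrib)
    also have "\<dots> = jackson q G (\<lambda>y. a * (w y * 1 / (x - y))) + cauchy (\<lambda>y. y * poly P y) x"
      unfolding cauchy_def
      by (intro jackson_add q_less bounded_image_mult bounded_image_const bounded_cauchy x b)
    also have "jackson q G (\<lambda>y. a * (w y * 1 / (x - y))) = a * cauchy (\<lambda>_. 1) x"
      unfolding cauchy_def by (intro jackson_cmult q_less bounded_cauchy x bounded_image_const)
    finally show ?thesis

      unfolding poly_pCons
      using cauchy_shift[OF x bounded_poly, of P] R[OF x] by (simp only: algebra_simps)
  qed
  thus ?case by blast
qed

lemma tendsto_cauchy_0:
  assumes "bounded (h ` nodes)"
  shows "(cauchy h \<longlongrightarrow> 0) at_infinity"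
proof -
  obtain B where B: "B > 0" "\<And>y. y \<in> nodes \<Longrightarrow> norm y \<le> B"
    using bounded_jackson_nodes[OF q_less, of G] unfolding bounded_pos by auto
  obtain M where M: "M > 0" "\<And>y. y \<in> nodes \<Longrightarrow> norm (w y * h y) \<le> M"
    using bounded_image_mult[OF bounded_weight assms] unfolding bounded_pos by auto
  obtain K where K: "K \<ge> 0"
    "\<And>h M. (\<And>y. y \<in> nodes \<Longrightarrow> norm (h y) \<le> M) \<Longrightarrow> 0 \<le> M \<Longrightarrow> norm (jackson q G h) \<le> K * M"
    using norm_jackson_le[OF q_less, of G] by blast
  \<comment> \<open>For \<open>norm x\<close> at least \<open>2 * B\<close>, every node has distance
    at least \<open>norm x / 2\<close> from \<open>x\<close>, so the uniform bound decays like
    \<open>1 / norm x\<close>.\<close>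
  have le: "norm (cauchy h x) \<le> K * (M * 2) * (1 / norm x)" if x: "norm x \<ge> 2 * B" for x
  proof -
    have "norm x > 0" using x B(1) by linarith
    have "norm (w y * h y / (x - y)) \<le> M / (norm x / 2)" if "y \<in> nodes" for y
    proof -
      have "norm x / 2 \<le> norm (x - y)"
        using B(2)[OF that] x norm_triangle_ineq2[of x y] by linarith
      thus ?thesis
        using M(2)[OF that] M(1) \<open>norm x > 0\<close> unfolding norm_divide by (intro frac_le) auto
    qed
    hence "norm (cauchy h x) \<le> K * (M / (norm x / 2))"
      unfolding cauchy_def using M(1) by (intro K(2)) auto
    thus ?thesis by simp
  qed
  have "((\<lambda>x::complex. K * (M * 2) * (1 / norm x)) \<longlongrightarrow> K * (M * 2) * 0) at_infinity"
    by (intro tendsto_intros tendsto_divide_0[OF tendsto_const] filterlim_at_top_imp_at_infinity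
        filterlim_norm_at_top)
  hence "((\<lambda>x::complex. K * (M * 2) * (1 / norm x)) \<longlongrightarrow> 0) at_infinity" by simp
  moreover have "eventually (\<lambda>x. norm (cauchy h x) \<le> K * (M * 2) * (1 / norm x)) at_infinity"
    using le unfolding eventually_at_infinity by blast
  ultimately show ?thesis
    by (rule Lim_null_comparison[rotated])
qed

lemma tendsto_mult_cauchy:
  assumes "bounded (h ` nodes)"
  shows "((\<lambda>x. x * cauchy h x) \<longlongrightarrow> jackson q G (\<lambda>y. w y * h y)) at_infinity"
proof -
  have b: "bounded ((\<lambda>y. y * h y) ` nodes)"
    using bounded_image_mult[of "\<lambda>y. y", OF _ assms] bounded_jackson_nodes[OF q_less] by simp
  have "((\<lambda>x. jackson q G (\<lambda>y. w y * h y) + cauchy (\<lambda>y. y * h y) x) \<longlongrightarrow> jackson q G (\<lambda>y. w y * h y) + 0) at_infinity"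
    by (intro tendsto_add tendsto_const tendsto_cauchy_0 b)
  moreover have "eventually (\<lambda>x. jackson q G (\<lambda>y. w y * h y) + cauchy (\<lambda>y. y * h y) x = x * cauchy h x) at_infinity"
    using eventually_not_node_at_infinity[OF q_less, of G]
    by eventually_elim (use cauchy_shift assms in auto)
  ultimately show ?thesis
    using Lim_transform_eventually by fastforce
qed

text \<open>A point where the weight vanishes carries no mass, so it is not a pole even if it is a node.\<close>

lemma tendsto_mult_cauchy_at:
  assumes "z \<noteq> 0" "w z = 0"
  shows "((\<lambda>x. (x - z) * cauchy (\<lambda>_. 1) x) \<longlongrightarrow> 0) (at z)"
proof -
  obtain d where d: "d > 0" "\<And>y. y \<in> nodes \<Longrightarrow> y \<noteq> z \<Longrightarrow> d \<le> norm (z - y)"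
    using jackson_nodes_separated[OF q_less assms(1), of G] by blast
  obtain M where M: "M > 0" "\<And>y. y \<in> nodes \<Longrightarrow> norm (w y) \<le> M"
    using bounded_weight unfolding bounded_pos by auto
  obtain K where K: "K \<ge> 0"
    "\<And>h M. (\<And>y. y \<in> nodes \<Longrightarrow> norm (h y) \<le> M) \<Longrightarrow> 0 \<le> M \<Longrightarrow> norm (jackson q G h) \<le> K * M"
    using norm_jackson_le[OF q_less, of G] by blast
  have le: "norm (cauchy (\<lambda>_. 1) x) \<le> K * (M / (d / 2))" if x: "dist x z < d / 2" for x
  proof -
    have "norm (w y * 1 / (x - y)) \<le> M / (d / 2)" if "y \<in> nodes" for y
    proof (cases "y = z")
      case True
      thus ?thesis using assms(2) M(1) d(1) by simp
    next
      case False
      have "d \<le> norm (z - y)" using d(2) that False by blast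
      also have "\<dots> \<le> norm (x - y) + norm (x - z)"
        using norm_triangle_ineq4[of "x - y" "x - z"] by simp
      finally have "d / 2 \<le> norm (x - y)" using x by (simp add: dist_norm)
      thus ?thesis using M(2)[OF that] M(1) d(1) unfolding norm_divide by (intro frac_le) auto
    qed
    thus ?thesis unfolding cauchy_def using M(1) d(1) by (intro K(2)) auto
  qed
  have "eventually (\<lambda>x. dist x z < d / 2) (at z)"
    using d(1) unfolding eventually_at by (intro exI[of _ "d / 2"]) auto
  hence "eventually (\<lambda>x. norm ((x - z) * cauchy (\<lambda>_. 1) x) \<le> norm (x - z) * (K * (M / (d / 2)))) (at z)"
  proof eventually_elim
    case (elim x)
    show ?case unfolding norm_mult by (intro mult_left_mono le elim norm_ge_zero)
  qed
  moreover have "((\<lambda>x. norm (x - z) * (K * (M / (d / 2)))) \<longlongrightarrow> norm (z - z) * (K * (M / (d / 2)))) (at z)"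
    by (intro tendsto_intros)
  ultimately show ?thesis by (simp add: Lim_null_comparison)
qed

end

section \<open>Orthogonality, second-kind functions and their Casoratian\<close>

locale orthonormal_system = jackson_weight +
  fixes p :: "nat \<Rightarrow> complex poly"
  assumes degree_p: "degree (p n) = n"
    and lead_coeff_p_nonzero: "lead_coeff (p n) \<noteq> 0"
    and orthonormal: "jackson q G (\<lambda>x. w x * poly (p n) x * poly (p m) x) = (if n = m then 1 else 0)"
begin

definition phi where "phi = cauchy (\<lambda>_. 1)"

definition second where "second n = cauchy (poly (p n))"

text \<open>The associated polynomial, that is, the integral of
  \<open>w(y) * (p_n(x) - p_n(y)) / (x - y)\<close>.\<close>

definition assoc where
  "assoc n = (SOME R. \<forall>x. x \<noteq> 0 \<and> x \<notin> nodes \<longrightarrow> poly (p n) x * phi x - second n x = poly R x)"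

lemma second_eq:
  assumes "x \<noteq> 0" "x \<notin> nodes"
  shows "second n x = poly (p n) x * phi x - poly (assoc n) x"
proof -
  have "\<forall>x. x \<noteq> 0 \<and> x \<notin> nodes \<longrightarrow> poly (p n) x * phi x - second n x = poly (assoc n) x"
    unfolding assoc_def using ex_associated_poly[of "p n"] unfolding phi_def second_def by (rule someI_ex)
  thus ?thesis using assms by (simp add: algebra_simps)
qed

lemma bounded_wpp: "bounded ((\<lambda>y. w y * (poly P y * poly Q y)) ` nodes)"
  by (intro bounded_image_mult bounded_weight bounded_poly)

text \<open>Bounding the coefficients instead of the degree lets the induction start at
  \<open>u = 0\<close>. A step removes the top coefficient with a multiple of \<open>p k\<close>,
  which is orthogonal to \<open>p n\<close> because \<open>k < n\<close>.\<close>

lemma orthogonal_lower: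
  assumes "\<forall>i\<ge>k. coeff u i = 0" "k \<le> n"
  shows "jackson q G (\<lambda>y. w y * (poly (p n) y * poly u y)) = 0"
  using assms
proof (induction k arbitrary: u)
  case 0
  hence "u = 0" by (intro poly_eqI) auto
  thus ?case by (simp add: jackson_zero)
next
  case (Suc k)
  define c where "c = coeff u k / lead_coeff (p k)"
  define v where "v = u - smult c (p k)"
  have "coeff v i = 0" if "i \<ge> k" for i
  proof (cases "i = k")
    case True
    thus ?thesis using lead_coeff_p_nonzero[of k] by (simp add: v_def c_def degree_p)
  next
    case False
    hence "i \<ge> Suc k" using that by simp
    thus ?thesis using Suc.prems(1) degree_p[of k] by (simp add: v_def coeff_eq_0)
  qed
  hence v: "jackson q G (\<lambda>y. w y * (poly (p n) y * poly v y)) = 0"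
    using Suc by simp
  have "u = v + smult c (p k)" by (simp add: v_def)
  hence "(\<lambda>y. w y * (poly (p n) y * poly u y)) =
      (\<lambda>y. w y * (poly (p n) y * poly v y) + c * (w y * (poly (p n) y * poly (p k) y)))"
    by (simp add: fun_eq_iff algebra_simps)
  hence "jackson q G (\<lambda>y. w y * (poly (p n) y * poly u y)) =
      0 + c * jackson q G (\<lambda>y. w y * (poly (p n) y * poly (p k) y))"
    using v jackson_add[OF q_less bounded_wpp bounded_image_mult[OF bounded_image_const bounded_wpp]]
      jackson_cmult[OF q_less bounded_wpp] by simp
  also have "\<dots> = 0"
    using orthonormal[of n k] Suc.prems(2) by (simp add: mult.assoc)
  finally show ?case .
qed

lemma moment_n: "jackson q G (\<lambda>y. w y * (poly (p n) y * y ^ n)) = 1 / lead_coeff (p n)"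
proof -
  define g where "g = lead_coeff (p n)"
  define v where "v = p n - smult g (monom 1 n)"
  have "coeff v i = 0" if "i \<ge> n" for i
    using that degree_p[of n] by (cases "i = n") (auto simp: v_def g_def coeff_eq_0)
  hence v: "jackson q G (\<lambda>y. w y * (poly (p n) y * poly v y)) = 0"
    using orthogonal_lower by blast
  have "p n = v + smult g (monom 1 n)" by (simp add: v_def)
  hence "(\<lambda>y. w y * (poly (p n) y * poly (p n) y)) =
      (\<lambda>y. w y * (poly (p n) y * poly v y) + g * (w y * (poly (p n) y * poly (monom 1 n) y)))"
    by (simp add: fun_eq_iff algebra_simps)
  hence "jackson q G (\<lambda>y. w y * (poly (p n) y * poly (p n) y)) =
      0 + g * jackson q G (\<lambda>y. w y * (poly (p n) y * poly (monom 1 n) y))"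
    using v jackson_add[OF q_less bounded_wpp bounded_image_mult[OF bounded_image_const bounded_wpp]]
      jackson_cmult[OF q_less bounded_wpp] by simp
  moreover have "jackson q G (\<lambda>y. w y * (poly (p n) y * poly (p n) y)) = 1"
    using orthonormal[of n n] by (simp add: mult.assoc)
  ultimately show ?thesis
    using lead_coeff_p_nonzero[of n] by (simp add: g_def field_simps poly_monom)
qed

text \<open>Each multiplication by \<open>x\<close> splits off a moment of \<open>p n\<close> of
  order below \<open>n\<close>, which vanishes. After \<open>n\<close> steps a Cauchy transform of
  order \<open>1 / x\<close> remains, whence the order \<open>- n - 1\<close> at infinity.\<close>

lemma power_mult_second:
  assumes "x \<noteq> 0" "x \<notin> nodes" "k \<le> n"
  shows "x ^ k * second n x = cauchy (\<lambda>y. poly (p n) y * y ^ k) x"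
  using assms(3)
proof (induction k)
  case (Suc k)
  have "bounded (poly (p n * monom 1 k) ` nodes)" by (rule bounded_poly)
  hence b: "bounded ((\<lambda>y. poly (p n) y * y ^ k) ` nodes)" by (simp add: poly_monom)
  have "jackson q G (\<lambda>y. w y * (poly (p n) y * poly (monom 1 k) y)) = 0"
    using Suc.prems by (intro orthogonal_lower[of "Suc k"]) auto
  hence "x * cauchy (\<lambda>y. poly (p n) y * y ^ k) x = cauchy (\<lambda>y. y * (poly (p n) y * y ^ k)) x"
    using cauchy_shift[OF assms(1,2) b] by (simp add: poly_monom)
  thus ?case using Suc by (simp add: mult_ac)
qed (simp add: second_def)

lemma tendsto_second:
  "((\<lambda>x. x ^ Suc n * second n x) \<longlongrightarrow> 1 / lead_coeff (p n)) at_infinity"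
proof -
  have "bounded (poly (p n * monom 1 n) ` nodes)" by (rule bounded_poly)
  hence b: "bounded ((\<lambda>y. poly (p n) y * y ^ n) ` nodes)" by (simp add: poly_monom)
  have "((\<lambda>x. x * cauchy (\<lambda>y. poly (p n) y * y ^ n) x) \<longlongrightarrow> 1 / lead_coeff (p n)) at_infinity"
    using tendsto_mult_cauchy[OF b] by (simp add: moment_n)
  moreover have "eventually (\<lambda>x. x * cauchy (\<lambda>y. poly (p n) y * y ^ n) x = x ^ Suc n * second n x) at_infinity"
    using eventually_not_node_at_infinity[OF q_less, of G]
    by eventually_elim (simp add: power_mult_second flip: mult.assoc)
  ultimately show ?thesis by (rule Lim_transform_eventually)
qed

lemma tendsto_p: "((\<lambda>x. poly (p n) x / x ^ n) \<longlongrightarrow> lead_coeff (p n)) at_infinity"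
  using poly_divide_tendsto_aux[of "p n"] by (simp add: degree_p)

text \<open>With \<open>phi\<close> eliminated the left side is
  \<open>p_n s_(n-1) - p_(n-1) s_n\<close>, a polynomial with a finite limit at infinity, hence
  constant. Only the first product contributes; the second is of order
  \<open>x^(-2)\<close>.\<close>

lemma casorati:
  assumes "n \<ge> 1"
  shows "poly (p (n - 1)) x * poly (assoc n) x - poly (p n) x * poly (assoc (n - 1)) x =
    lead_coeff (p n) / lead_coeff (p (n - 1))"
proof -
  let ?F = "\<lambda>x. poly (p (n - 1)) x * poly (assoc n) x - poly (p n) x * poly (assoc (n - 1)) x"
  define m where "m = n - 1"
  have n: "n = Suc m" using assms by (simp add: m_def)
  have "((\<lambda>x. (poly (p n) x / x ^ n) * (x ^ Suc m * second m x) -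
      (poly (p m) x / x ^ m) * (x ^ Suc n * second n x) * (1 / x ^ 2)) \<longlongrightarrow>
      lead_coeff (p n) * (1 / lead_coeff (p m)) - lead_coeff (p m) * (1 / lead_coeff (p n)) * 0) at_infinity"
    by (intro tendsto_diff tendsto_mult tendsto_p tendsto_second tendsto_inverse_power_at_infinity) auto
  moreover have "eventually (\<lambda>x. (poly (p n) x / x ^ n) * (x ^ Suc m * second m x) -
      (poly (p m) x / x ^ m) * (x ^ Suc n * second n x) * (1 / x ^ 2) = ?F x / x ^ 0) at_infinity"
    using eventually_not_node_at_infinity[OF q_less, of G]
  proof eventually_elim
    case (elim x)
    hence "(poly (p n) x / x ^ n) * (x ^ Suc m * second m x) -
      (poly (p m) x / x ^ m) * (x ^ Suc n * second n x) * (1 / x ^ 2) =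
      poly (p n) x * second m x - poly (p m) x * second n x"
      by (simp add: n power2_eq_square)
    also have "\<dots> = ?F x"
      using elim by (simp add: second_eq m_def algebra_simps)
    finally show ?case by simp
  qed
  ultimately have "((\<lambda>x. ?F x / x ^ 0) \<longlongrightarrow>
      lead_coeff (p n) * (1 / lead_coeff (p m)) - lead_coeff (p m) * (1 / lead_coeff (p n)) * 0) at_infinity"
    by (rule Lim_transform_eventually)
  hence "((\<lambda>x. ?F x / x ^ 0) \<longlongrightarrow> lead_coeff (p n) / lead_coeff (p m)) at_infinity"
    by simp
  moreover have "polyfun ?F" by (intro polyfun_diff polyfun_mult polyfun_poly)
  ultimately obtain P where P: "degree P \<le> 0" "coeff P 0 = lead_coeff (p n) / lead_coeff (p m)"
      "\<forall>x. ?F x = poly P x"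
    using polyfun_tendsto_coeff[of ?F 0] by blast
  obtain a where "P = [:a:]" using P(1) degree_eq_zeroE by blast
  thus ?thesis using P by (simp add: m_def)
qed

end

subsection \<open>The spectral system\<close>

lemma poly_as_sum_le:
  fixes P :: "'a :: comm_ring_1 poly"
  assumes "degree P \<le> k"
  shows "poly P x = (\<Sum>i\<le>k. coeff P i * x ^ i)"
  unfolding poly_altdef using assms by (intro sum.mono_neutral_left) (auto simp: coeff_eq_0)

lemma poly_tendsto_coeff:
  fixes P :: "complex poly"
  assumes "((\<lambda>x. poly P x / x ^ k) \<longlongrightarrow> L) at_infinity"
  shows "degree P \<le> k \<and> coeff P k = L"
proof -
  obtain Q where Q: "degree Q \<le> k \<and> coeff Q k = L" "\<forall>x. poly P x = poly Q x"
    using polyfun_tendsto_coeff[OF polyfun_poly assms] by blast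
  have "poly P = poly Q" using Q(2) by (intro ext) simp
  hence "P = Q" by (simp only: poly_eq_poly_eq_iff)
  thus ?thesis using Q(1) by simp
qed

lemma polyfun_eventually_nonzero:
  assumes "polyfun F" "F z0 \<noteq> 0"
  shows "eventually (\<lambda>x. F x \<noteq> 0) (at z)"
proof -
  have "finite {x. F x = 0}" using polyfun_eq_0[OF assms(1)] assms(2) by blast
  hence "\<not> z islimpt {x. F x = 0}" by (rule islimpt_finite)
  thus ?thesis by (simp add: islimpt_iff_eventually)
qed

lemma polyfun_D_plus: "polyfun (\<lambda>x. D_plus b x t)"
  and polyfun_D_minus: "polyfun (\<lambda>x. D_minus b x t)"
  and polyfun_E_plus: "polyfun (\<lambda>x. E_plus q b x t)"
  and polyfun_E_minus: "polyfun (\<lambda>x. E_minus q b x t)"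
  unfolding D_plus_def D_minus_def E_plus_def E_minus_def by (intro polyfun_intros)+

lemmas polyfun_D_E = polyfun_D_plus polyfun_D_minus polyfun_E_plus polyfun_E_minus
  polyfun_E_plus[THEN polyfun_comp] polyfun_E_minus[THEN polyfun_comp]

section \<open>Limits under scaling and at infinity\<close>

lemma filterlim_scale_at:
  fixes q z :: complex
  assumes "q \<noteq> 0"
  shows "filterlim (\<lambda>x. q * x) (at (q * z)) (at z)"
proof -
  have "((\<lambda>x. q * x) \<longlongrightarrow> q * z) (at z)" by (intro tendsto_intros)
  moreover have "eventually (\<lambda>x. q * x \<noteq> q * z) (at z)"
    using assms by (auto simp: eventually_at_filter)
  ultimately show ?thesis
    by (auto simp: filterlim_at elim: eventually_mono)
qed

lemma eventually_at_scale:
  fixes q z :: complex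
  assumes "q \<noteq> 0" "eventually P (at (q * z))"
  shows "eventually (\<lambda>x. P (q * x)) (at z)"
  using filterlim_scale_at[OF assms(1)] assms(2) by (auto simp: filterlim_iff)

lemma filterlim_scale_at_infinity:
  fixes q :: complex
  assumes "q \<noteq> 0"
  shows "filterlim (\<lambda>x. q * x) at_infinity at_infinity"
  by (rule tendsto_mult_filterlim_at_infinity[OF tendsto_const assms filterlim_ident])

lemma eventually_at_infinity_scale:
  fixes q :: complex
  assumes "q \<noteq> 0" "eventually P at_infinity"
  shows "eventually (\<lambda>x. P (q * x)) at_infinity"
  using filterlim_scale_at_infinity[OF assms(1)] assms(2) by (auto simp: filterlim_iff)

lemma tendsto_linear_at_infinity:
  fixes a c :: complex
  shows "((\<lambda>x. (a + c * x) / x) \<longlongrightarrow> c) at_infinity"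
proof -
  have "((\<lambda>x. a * (1 / x ^ 1) + c) \<longlongrightarrow> a * 0 + c) at_infinity"
    by (intro tendsto_intros tendsto_inverse_power_at_infinity) auto
  moreover have "eventually (\<lambda>x. a * (1 / x ^ 1) + c = (a + c * x) / x) at_infinity"
    unfolding eventually_at_infinity
    by (intro exI[of _ 1]) (auto simp: divide_simps)
  ultimately show ?thesis using Lim_transform_eventually by fastforce
qed

lemma tendsto_D_plus: "((\<lambda>x. D_plus b x t / x ^ 3) \<longlongrightarrow> - (b 6 ^ 2 * b 1 * b 4)) at_infinity"
proof -
  have "((\<lambda>x. b 6 * ((1 + (- b 1) * x) / x) * ((1 + (- b 4) * x) / x) * ((t + (- b 6) * x) / x)) \<longlongrightarrow>
      b 6 * (- b 1) * (- b 4) * (- b 6)) at_infinity"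
    by (intro tendsto_mult tendsto_const tendsto_linear_at_infinity)
  thus ?thesis by (simp add: D_plus_def power3_eq_cube power2_eq_square mult_ac)
qed

lemma tendsto_D_minus: "((\<lambda>x. D_minus b x t / x ^ 3) \<longlongrightarrow> - (b 2 * b 3)) at_infinity"
proof -
  have "((\<lambda>x. ((1 + (- b 2) * x) / x) * ((1 + (- b 3) * x) / x) * ((b 6 * t + (- 1) * x) / x)) \<longlongrightarrow>
      (- b 2) * (- b 3) * (- 1)) at_infinity"
    by (intro tendsto_mult tendsto_const tendsto_linear_at_infinity)
  thus ?thesis by (simp add: D_minus_def power3_eq_cube mult_ac)
qed

context orthonormal_system begin

lemma tendsto_p_scaled:
  assumes "q \<noteq> 0"
  shows "((\<lambda>x. poly (p n) (q * x) / x ^ n) \<longlongrightarrow> lead_coeff (p n) * q ^ n) at_infinity"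
proof -
  have "((\<lambda>x. poly (p n) (q * x) / (q * x) ^ n * q ^ n) \<longlongrightarrow> lead_coeff (p n) * q ^ n) at_infinity"
    by (intro tendsto_mult tendsto_const filterlim_compose[OF tendsto_p] filterlim_scale_at_infinity assms)
  thus ?thesis using assms by (simp add: power_mult_distrib)
qed

lemma tendsto_second_scaled:
  assumes "q \<noteq> 0"
  shows "((\<lambda>x. x ^ Suc n * second n (q * x)) \<longlongrightarrow> 1 / (lead_coeff (p n) * q ^ Suc n)) at_infinity"
proof -
  have "((\<lambda>x. (q * x) ^ Suc n * second n (q * x) / q ^ Suc n) \<longlongrightarrow> 1 / lead_coeff (p n) / q ^ Suc n) at_infinity"
    using assms
    by (intro tendsto_divide tendsto_const filterlim_compose[OF tendsto_second] filterlim_scale_at_infinity) auto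
  thus ?thesis using assms by (simp add: power_mult_distrib mult.assoc)
qed

definition good where "good x \<longleftrightarrow> x \<noteq> 0 \<and> x \<notin> nodes"

lemma eventually_good_at: "z \<noteq> 0 \<Longrightarrow> eventually good (at z)"
  unfolding good_def using eventually_not_node_at[OF q_less] .

lemma eventually_good_at_infinity: "eventually good at_infinity"
  unfolding good_def using eventually_not_node_at_infinity[OF q_less] .

lemma second_good: "good x \<Longrightarrow> second n x = poly (p n) x * phi x - poly (assoc n) x"
  unfolding good_def using second_eq by blast

end

text \<open>The matrix equation is kept as four polynomial identities, so that it can be used at 0.
  In the second column \<open>D_plus / w(q x) = D_minus / w(x)\<close> removes the weight, and
  \<open>s = p * phi - r\<close> together with \<open>phi_spectral\<close> removes
  \<open>phi\<close>; the term with \<open>S\<close> is what \<open>phi_spectral\<close> leaves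
  behind.\<close>

locale spectral_system = orthonormal_system +
  fixes b :: "nat \<Rightarrow> complex" and t :: complex and n :: nat and S Wp Tp Tm Wm :: "complex poly"
  assumes q_nz: "q \<noteq> 0" and n_pos: "n \<ge> 1" and t_nz: "t \<noteq> 0" and b6_nz: "b 6 \<noteq> 0"
    and phi_spectral: "good x \<Longrightarrow> good (q * x) \<Longrightarrow>
      D_minus b x t * phi (q * x) = D_plus b x t * phi x + (q - 1) * x * poly S x"
    and p_spectral: "D_plus b x t * poly (p n) (q * x) = poly Wp x * poly (p n) x - poly Tp x * poly (p (n - 1)) x"
    and p1_spectral: "D_plus b x t * poly (p (n - 1)) (q * x) = poly Tm x * poly (p n) x + poly Wm x * poly (p (n - 1)) x"
    and r_spectral: "D_minus b x t * poly (assoc n) (q * x) - (q - 1) * x * poly S x * poly (p n) (q * x) =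
      poly Wp x * poly (assoc n) x - poly Tp x * poly (assoc (n - 1)) x"
    and r1_spectral: "D_minus b x t * poly (assoc (n - 1)) (q * x) - (q - 1) * x * poly S x * poly (p (n - 1)) (q * x) =
      poly Tm x * poly (assoc n) x + poly Wm x * poly (assoc (n - 1)) x"
begin

abbreviation "c \<equiv> lead_coeff (p n) / lead_coeff (p (n - 1))"

lemma c_nz: "c \<noteq> 0"
  using lead_coeff_p_nonzero by auto

lemma casorati_n: "poly (p (n - 1)) x * poly (assoc n) x - poly (p n) x * poly (assoc (n - 1)) x = c"
  using casorati[OF n_pos] .

lemma casorati_second: "good x \<Longrightarrow> poly (p n) x * second (n - 1) x - poly (p (n - 1)) x * second n x = c"
  using casorati_n[of x] by (simp add: second_good algebra_simps)

lemma second_spectral: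
  assumes "good x" "good (q * x)"
  shows "D_minus b x t * second n (q * x) = poly Wp x * second n x - poly Tp x * second (n - 1) x"
    and "D_minus b x t * second (n - 1) (q * x) = poly Tm x * second n x + poly Wm x * second (n - 1) x"
proof -
  have *: "D_minus b x t * (A * phi (q * x) - r) =
      (D_plus b x t * A) * phi x - (D_minus b x t * r - (q - 1) * x * poly S x * A)" for A r
    using phi_spectral[OF assms] by algebra
  show "D_minus b x t * second n (q * x) = poly Wp x * second n x - poly Tp x * second (n - 1) x"
    unfolding second_good[OF assms(1)] second_good[OF assms(2)] *
    unfolding p_spectral r_spectral by (simp add: algebra_simps)
  show "D_minus b x t * second (n - 1) (q * x) = poly Tm x * second n x + poly Wm x * second (n - 1) x"
    unfolding second_good[OF assms(1)] second_good[OF assms(2)] *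
    unfolding p1_spectral r1_spectral by (simp add: algebra_simps)
qed

lemma eventually_good2_at: "z \<noteq> 0 \<Longrightarrow> eventually (\<lambda>x. good x \<and> good (q * x)) (at z)"
  using q_nz by (intro eventually_conj eventually_good_at eventually_at_scale) auto

lemma eventually_good2_at_infinity: "eventually (\<lambda>x. good x \<and> good (q * x)) at_infinity"
  using q_nz by (intro eventually_conj eventually_good_at_infinity eventually_at_infinity_scale) auto

text \<open>The Casoratian of \<open>p\<close> and \<open>s\<close> has the same value
  \<open>c\<close> at \<open>x\<close> and \<open>q * x\<close>, so the determinant of the matrix
  equals the product of the factors \<open>D_plus\<close> and \<open>D_minus\<close> by which the
  two shifted columns are scaled.\<close>

lemma det_spectral: "poly Wp x * poly Wm x + poly Tp x * poly Tm x = D_plus b x t * D_minus b x t"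
proof -
  have "\<forall>x. poly Wp x * poly Wm x + poly Tp x * poly Tm x = D_plus b x t * D_minus b x t"
  proof (rule polyfun_eq_at[where z = 1])
    have "eventually (\<lambda>x. good x \<and> good (q * x)) (at 1)" by (rule eventually_good2_at) simp
    thus "eventually (\<lambda>x. poly Wp x * poly Wm x + poly Tp x * poly Tm x = D_plus b x t * D_minus b x t) (at 1)"
    proof eventually_elim
      case (elim x)
      have "(poly Wp x * poly Wm x + poly Tp x * poly Tm x) * c = D_plus b x t * D_minus b x t * c"
        using p_spectral[of x] p1_spectral[of x] second_spectral[of x] casorati_second[of x] casorati_second[of "q * x"] elim
        by algebra
      thus ?case using c_nz by simp
    qed
  qed (intro polyfun_intros polyfun_D_E)+
  thus ?thesis by blast
qed

lemma D_plus_0: "D_plus b 0 t = b 6 * t" and D_minus_0: "D_minus b 0 t = b 6 * t"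
  by (simp_all add: D_plus_def D_minus_def)

lemma D_nz: "eventually (\<lambda>x. D_plus b x t \<noteq> 0) (at z)" "eventually (\<lambda>x. D_minus b x t \<noteq> 0) (at z)"
  by (rule polyfun_eventually_nonzero[OF polyfun_D_plus, of _ 0], simp add: D_plus_0 t_nz b6_nz)
    (rule polyfun_eventually_nonzero[OF polyfun_D_minus, of _ 0], simp add: D_minus_0 t_nz b6_nz)

text \<open>The adjugate matrix applied to the shifted column; the determinant produces
  \<open>D_plus * D_minus\<close>, and \<open>D_plus\<close> cancels.\<close>

lemma p_inverse: "D_minus b x t * poly (p n) x = poly Wm x * poly (p n) (q * x) + poly Tp x * poly (p (n - 1)) (q * x)"
proof -
  have "\<forall>x. D_minus b x t * poly (p n) x = poly Wm x * poly (p n) (q * x) + poly Tp x * poly (p (n - 1)) (q * x)"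
  proof (rule polyfun_eq_at[where z = 1])
    show "eventually (\<lambda>x. D_minus b x t * poly (p n) x =
        poly Wm x * poly (p n) (q * x) + poly Tp x * poly (p (n - 1)) (q * x)) (at 1)"
      using D_nz(1)
    proof eventually_elim
      case (elim x)
      have "D_plus b x t * (D_minus b x t * poly (p n) x) =
          D_plus b x t * (poly Wm x * poly (p n) (q * x) + poly Tp x * poly (p (n - 1)) (q * x))"
        using p_spectral[of x] p1_spectral[of x] det_spectral[of x] by algebra
      thus ?case using elim by simp
    qed
  qed (intro polyfun_intros polyfun_D_E)+
  thus ?thesis by blast
qed

lemma second_inverse:
  assumes "good x" "good (q * x)" "D_minus b x t \<noteq> 0"
  shows "D_plus b x t * second n x = poly Wm x * second n (q * x) + poly Tp x * second (n - 1) (q * x)"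
proof -
  have "D_minus b x t * (D_plus b x t * second n x) =
      D_minus b x t * (poly Wm x * second n (q * x) + poly Tp x * second (n - 1) (q * x))"
    using second_spectral[OF assms(1,2)] det_spectral[of x] by algebra
  thus ?thesis using assms(3) by simp
qed

text \<open>At the fixed point 0 of the shift, \<open>D_plus = D_minus = b 6 * t\<close>, so the
  matrix multiplies both columns \<open>(p, r)\<close> by \<open>b 6 * t\<close>. They are
  independent, their Casoratian being \<open>c\<close>, hence the matrix is scalar there.\<close>

lemma at_0: "poly Wp 0 = b 6 * t" "poly Wm 0 = b 6 * t" "poly Tp 0 = 0" "poly Tm 0 = 0"
proof -
  note eqs = p_spectral[of 0] p1_spectral[of 0] r_spectral[of 0] r1_spectral[of 0] casorati_n[of 0]
  note eqs = eqs[unfolded D_plus_0 D_minus_0 mult_zero_right mult_zero_left diff_zero]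
  have "(poly Wp 0 - b 6 * t) * c = 0" "(poly Wm 0 - b 6 * t) * c = 0" "poly Tp 0 * c = 0" "poly Tm 0 * c = 0"
    using eqs by algebra+
  thus "poly Wp 0 = b 6 * t" "poly Wm 0 = b 6 * t" "poly Tp 0 = 0" "poly Tm 0 = 0"
    using c_nz by auto
qed

text \<open>The off-diagonal entries vanish at 0 and contribute to the determinant only from order
  two on. Its linear coefficient is therefore \<open>b 6 * t\<close> times the derivative of the
  trace.\<close>

lemma derivative_0:
  "coeff Wp 1 + coeff Wm 1 = - (b 6 * t * (b 1 + b 2 + b 3 + b 4) + b 6 ^ 2 + 1)"
proof -
  define Dp where "Dp = [:b 6:] * [:1, - b 1:] * [:1, - b 4:] * [:t, - b 6:]"
  define Dm where "Dm = [:1, - b 2:] * [:1, - b 3:] * [:b 6 * t, - 1:]"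
  have "poly (Wp * Wm + Tp * Tm) x = poly (Dp * Dm) x" for x
  proof -
    have "poly Dp x = D_plus b x t" "poly Dm x = D_minus b x t"
      by (simp_all add: Dp_def Dm_def D_plus_def D_minus_def algebra_simps)
    thus ?thesis using det_spectral[of x] by simp
  qed
  hence "poly (Wp * Wm + Tp * Tm) = poly (Dp * Dm)" by (intro ext)
  hence "Wp * Wm + Tp * Tm = Dp * Dm" by (simp only: poly_eq_poly_eq_iff)
  hence "coeff (Wp * Wm + Tp * Tm) 1 = coeff (Dp * Dm) 1" by simp
  moreover have "coeff Wp 0 = b 6 * t" "coeff Wm 0 = b 6 * t" "coeff Tp 0 = 0" "coeff Tm 0 = 0"
    using at_0 by (simp_all add: poly_0_coeff_0)
  ultimately have "b 6 * t * (coeff Wp 1 + coeff Wm 1) =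
      b 6 * t * (- (b 6 * t * (b 1 + b 2 + b 3 + b 4) + b 6 ^ 2 + 1))"
    by (simp add: coeff_mult Dp_def Dm_def algebra_simps power2_eq_square)
  thus ?thesis using t_nz b6_nz by simp
qed

text \<open>By Cramer's rule \<open>c * Wp\<close> is a difference of two products, with
  \<open>c\<close> as denominator. The first is of order \<open>x^3\<close>, the second smaller by
  \<open>x^(-2)\<close>; the extra \<open>1 / x ^ 2\<close> in \<open>?F\<close> records
  this.\<close>

lemma Wp_lead: "degree Wp \<le> 3 \<and> coeff Wp 3 = - (b 6 ^ 2 * b 1 * b 4 * q ^ n)"
proof -
  define m where "m = n - 1"
  have n: "n = Suc m" using n_pos by (simp add: m_def)
  let ?F = "\<lambda>x. (D_plus b x t / x ^ 3) * (poly (p n) (q * x) / x ^ n) * (x ^ Suc m * second m x)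
    - (D_minus b x t / x ^ 3) * (x ^ Suc n * second n (q * x)) * (poly (p m) x / x ^ m) * (1 / x ^ 2)"
  have "(?F \<longlongrightarrow> (- (b 6 ^ 2 * b 1 * b 4)) * (lead_coeff (p n) * q ^ n) * (1 / lead_coeff (p m))
     - (- (b 2 * b 3)) * (1 / (lead_coeff (p n) * q ^ Suc n)) * lead_coeff (p m) * 0) at_infinity"
    by (intro tendsto_diff tendsto_mult tendsto_D_plus tendsto_D_minus tendsto_p_scaled tendsto_second_scaled
        tendsto_p tendsto_second q_nz tendsto_inverse_power_at_infinity) simp
  moreover have "eventually (\<lambda>x. ?F x = c * poly Wp x / x ^ 3) at_infinity"
    using eventually_good2_at_infinity
  proof eventually_elim
    case (elim x)
    have "x \<noteq> 0" using elim by (simp add: good_def)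
    have "?F x = (D_plus b x t * poly (p n) (q * x) * second m x - D_minus b x t * second n (q * x) * poly (p m) x) / x ^ 3"
      using \<open>x \<noteq> 0\<close> by (simp add: n diff_divide_distrib power2_eq_square mult.assoc mult.commute mult.left_commute)
    also have "D_plus b x t * poly (p n) (q * x) * second m x - D_minus b x t * second n (q * x) * poly (p m) x
        = c * poly Wp x"
      using p_spectral[of x] second_spectral(1)[of x] casorati_second[of x] elim unfolding m_def by algebra
    finally show ?case .
  qed
  ultimately have "((\<lambda>x. (c * poly Wp x) / x ^ 3) \<longlongrightarrow> c * (- (b 6 ^ 2 * b 1 * b 4 * q ^ n))) at_infinity"
    by (rule Lim_transform_eventually[THEN tendsto_eq_rhs]) (simp add: m_def)
  hence "((\<lambda>x. inverse c * ((c * poly Wp x) / x ^ 3)) \<longlongrightarrow> inverse c * (c * (- (b 6 ^ 2 * b 1 * b 4 * q ^ n)))) at_infinity"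
    by (intro tendsto_mult tendsto_const)
  moreover have "inverse c * ((c * y) / z) = y / z" "inverse c * (c * y) = y" for y z
    using c_nz by simp_all
  ultimately have "((\<lambda>x. poly Wp x / x ^ 3) \<longlongrightarrow> - (b 6 ^ 2 * b 1 * b 4 * q ^ n)) at_infinity"
    by (simp add: mult.assoc)
  thus ?thesis by (rule poly_tendsto_coeff)
qed

lemma Wm_lead: "degree Wm \<le> 3 \<and> coeff Wm 3 = - (b 2 * b 3 / q ^ n)"
proof -
  define m where "m = n - 1"
  have n: "n = Suc m" using n_pos by (simp add: m_def)
  let ?F = "\<lambda>x. (D_minus b x t / x ^ 3) * (poly (p n) x / x ^ n) * (x ^ Suc m * second m (q * x))
    - (D_plus b x t / x ^ 3) * (x ^ Suc n * second n x) * (poly (p m) (q * x) / x ^ m) * (1 / x ^ 2)"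
  have "(?F \<longlongrightarrow> (- (b 2 * b 3)) * lead_coeff (p n) * (1 / (lead_coeff (p m) * q ^ Suc m))
     - (- (b 6 ^ 2 * b 1 * b 4)) * (1 / lead_coeff (p n)) * (lead_coeff (p m) * q ^ m) * 0) at_infinity"
    by (intro tendsto_diff tendsto_mult tendsto_D_plus tendsto_D_minus tendsto_p_scaled tendsto_second_scaled
        tendsto_p tendsto_second q_nz tendsto_inverse_power_at_infinity) simp
  moreover have "eventually (\<lambda>x. ?F x = c * poly Wm x / x ^ 3) at_infinity"
    using eventually_good2_at_infinity
  proof eventually_elim
    case (elim x)
    have "x \<noteq> 0" using elim by (simp add: good_def)
    have "?F x = (D_minus b x t * second m (q * x) * poly (p n) x - D_plus b x t * poly (p m) (q * x) * second n x) / x ^ 3"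
      using \<open>x \<noteq> 0\<close> by (simp add: n diff_divide_distrib power2_eq_square mult.assoc mult.commute mult.left_commute)
    also have "D_minus b x t * second m (q * x) * poly (p n) x - D_plus b x t * poly (p m) (q * x) * second n x
        = c * poly Wm x"
      using p1_spectral[of x] second_spectral(2)[of x] casorati_second[of x] elim unfolding m_def by algebra
    finally show ?case .
  qed
  ultimately have "((\<lambda>x. (c * poly Wm x) / x ^ 3) \<longlongrightarrow> c * (- (b 2 * b 3 / q ^ n))) at_infinity"
    by (rule Lim_transform_eventually[THEN tendsto_eq_rhs]) (simp add: n)
  hence "((\<lambda>x. inverse c * ((c * poly Wm x) / x ^ 3)) \<longlongrightarrow> inverse c * (c * (- (b 2 * b 3 / q ^ n)))) at_infinity"
    by (intro tendsto_mult tendsto_const)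
  moreover have "inverse c * ((c * y) / z) = y / z" "inverse c * (c * y) = y" for y z
    using c_nz by simp_all
  ultimately have "((\<lambda>x. poly Wm x / x ^ 3) \<longlongrightarrow> - (b 2 * b 3 / q ^ n)) at_infinity"
    by simp
  thus ?thesis by (rule poly_tendsto_coeff)
qed

text \<open>Here both products in Cramer's rule have order \<open>x^2\<close>, so both enter the
  leading coefficient.\<close>

lemma Tp_lead: "degree Tp \<le> 2 \<and> c * coeff Tp 2 = b 2 * b 3 / q ^ Suc n - b 6 ^ 2 * b 1 * b 4 * q ^ n"
proof -
  let ?F = "\<lambda>x. (D_plus b x t / x ^ 3) * (poly (p n) (q * x) / x ^ n) * (x ^ Suc n * second n x)
    - (D_minus b x t / x ^ 3) * (x ^ Suc n * second n (q * x)) * (poly (p n) x / x ^ n)"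
  have "(?F \<longlongrightarrow> (- (b 6 ^ 2 * b 1 * b 4)) * (lead_coeff (p n) * q ^ n) * (1 / lead_coeff (p n))
     - (- (b 2 * b 3)) * (1 / (lead_coeff (p n) * q ^ Suc n)) * lead_coeff (p n)) at_infinity"
    by (intro tendsto_diff tendsto_mult tendsto_D_plus tendsto_D_minus tendsto_p_scaled tendsto_second_scaled
        tendsto_p tendsto_second q_nz)
  moreover have "eventually (\<lambda>x. ?F x = poly (smult c Tp) x / x ^ 2) at_infinity"
    using eventually_good2_at_infinity
  proof eventually_elim
    case (elim x)
    have "x \<noteq> 0" using elim by (simp add: good_def)
    have "?F x = (D_plus b x t * poly (p n) (q * x) * second n x - D_minus b x t * second n (q * x) * poly (p n) x) / x ^ 2"
      using \<open>x \<noteq> 0\<close> by (simp add: diff_divide_distrib power2_eq_square power3_eq_cube mult.assoc mult.commute mult.left_commute)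
    also have "D_plus b x t * poly (p n) (q * x) * second n x - D_minus b x t * second n (q * x) * poly (p n) x
        = c * poly Tp x"
      using p_spectral[of x] second_spectral(1)[of x] casorati_second[of x] elim by algebra
    finally show ?case by simp
  qed
  ultimately have "((\<lambda>x. poly (smult c Tp) x / x ^ 2) \<longlongrightarrow> b 2 * b 3 / q ^ Suc n - b 6 ^ 2 * b 1 * b 4 * q ^ n) at_infinity"
    by (rule Lim_transform_eventually[THEN tendsto_eq_rhs]) (use lead_coeff_p_nonzero in simp)
  hence "degree (smult c Tp) \<le> 2 \<and> coeff (smult c Tp) 2 = b 2 * b 3 / q ^ Suc n - b 6 ^ 2 * b 1 * b 4 * q ^ n"
    by (rule poly_tendsto_coeff)
  thus ?thesis using c_nz by simp
qed

end

subsection \<open>The deformation\<close>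

locale lax_pair =
  A: spectral_system q G w p b t n S Wp Tp Tm Wm +
  B: spectral_system q G' w' p' b "q * t" n S' Wp' Tp' Tm' Wm'
  for q G w p b t n S Wp Tp Tm Wm G' w' p' S' Wp' Tp' Tm' Wm' +
  fixes T :: "complex poly"
  assumes phi_deformation: "A.good x \<Longrightarrow> B.good x \<Longrightarrow>
      E_minus q b x t * B.phi x = E_plus q b x t * A.phi x + (q - 1) * t * poly T x"
    and weight_pole: "w (t / b 6) = 0" "w' (q * (t / b 6)) = 0"
    \<comment> \<open>These points are poles of the weights, where the formal quotient takes the value \<open>x / 0 = 0\<close>.\<close>
begin

abbreviation "pn \<equiv> poly (p n)"
abbreviation "pn1 \<equiv> poly (p (n - 1))"
abbreviation "rn \<equiv> poly (A.assoc n)"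
abbreviation "rn1 \<equiv> poly (A.assoc (n - 1))"
abbreviation "sn \<equiv> A.second n"
abbreviation "sn1 \<equiv> A.second (n - 1)"
abbreviation "pn' \<equiv> poly (p' n)"
abbreviation "pn1' \<equiv> poly (p' (n - 1))"
abbreviation "rn' \<equiv> poly (B.assoc n)"
abbreviation "rn1' \<equiv> poly (B.assoc (n - 1))"
abbreviation "sn' \<equiv> B.second n"
abbreviation "sn1' \<equiv> B.second (n - 1)"
abbreviation "lc \<equiv> lead_coeff (p n)"
abbreviation "lc' \<equiv> lead_coeff (p' n)"

definition ok where
  "ok x \<longleftrightarrow> A.good x \<and> A.good (q * x) \<and> B.good x \<and> B.good (q * x) \<and> x \<noteq> t / b 6"

lemma eventually_ok_at: "z \<noteq> 0 \<Longrightarrow> eventually ok (at z)"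
proof -
  assume "z \<noteq> 0"
  moreover have "eventually (\<lambda>x. x \<noteq> t / b 6) (at z)"
    by (rule eventually_neq_at_within)
  ultimately show ?thesis
    using A.eventually_good2_at[of z] B.eventually_good2_at[of z]
    unfolding ok_def by (simp add: eventually_conj_iff)
qed

lemma eventually_ok_at_infinity: "eventually ok at_infinity"
proof -
  have "eventually (\<lambda>x. x \<noteq> t / b 6) at_infinity"
    by (rule eventually_not_equal_at_infinity)
  thus ?thesis
    using A.eventually_good2_at_infinity B.eventually_good2_at_infinity
    unfolding ok_def by eventually_elim auto
qed

lemma E_plus_scaled: "b 6 * E_plus q b (q * x) t = q * (b 6 * t - x)"
  using A.b6_nz by (simp add: E_plus_def field_simps)

lemma E_minus_scaled: "E_minus q b (q * x) t = q * (t - b 6 * x)"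
  by (simp add: E_minus_def algebra_simps)

text \<open>The equation of the Stieltjes function under the diagonal shift
  \<open>(x, t) -> (q x, q t)\<close>. The spectral equation at \<open>(x, t)\<close> and the
  deformation equation at \<open>(q x, t)\<close> give it only up to the factor
  \<open>t - b 6 * x\<close>, common to \<open>D_plus b x t\<close> and
  \<open>E_minus q b (q * x) t\<close>. Division is possible once the inhomogeneous term
  \<open>?Z\<close> vanishes at \<open>t / b 6\<close>. The value at 0 is recorded apart because
  \<open>ok\<close> excludes 0.\<close>

lemma ex_kernel_poly:
  "\<exists>K. (\<forall>x. ok x \<longrightarrow> (1 - b 1 * x) * (1 - b 4 * x) * A.phi x - (1 - b 2 * x) * (1 - b 3 * x) * B.phi (q * x) = poly K x)
     \<and> poly K 0 * q = - ((q - 1) * poly T 0)"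
proof -
  let ?x1 = "t / b 6"
  let ?F = "\<lambda>x. (1 - b 1 * x) * (1 - b 4 * x) * A.phi x - (1 - b 2 * x) * (1 - b 3 * x) * B.phi (q * x)"
  let ?Z = "\<lambda>x. - (q / b 6) * (q - 1) * x * poly S x - (q - 1) * t * poly T (q * x) * (1 - b 2 * x) * (1 - b 3 * x)"
  have Z: "q * (t - b 6 * x) * ?F x = ?Z x" if "ok x" for x
  proof -
    have g: "A.good x" "A.good (q * x)" "B.good (q * x)" using that by (auto simp: ok_def)
    have "b 6 * (q * (t - b 6 * x) * ?F x) = b 6 * ?Z x"
      using phi_deformation[OF g(2,3)] A.phi_spectral[OF g(1,2)] E_plus_scaled[of x] E_minus_scaled[of x] A.b6_nz
      unfolding D_plus_def D_minus_def by (simp add: field_simps) algebra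
    thus ?thesis using A.b6_nz by simp
  qed
  have x1: "?x1 \<noteq> 0" using A.t_nz A.b6_nz by simp
  \<comment> \<open>Both weights are 0 at the points in question, so the two Stieltjes functions
    stay bounded near them and their products with the vanishing linear factors tend to 0.\<close>
  have "((\<lambda>x. - (b 6 * q) * ((1 - b 1 * x) * (1 - b 4 * x)) * ((x - ?x1) * A.phi x)
      + b 6 * ((1 - b 2 * x) * (1 - b 3 * x)) * ((q * x - q * ?x1) * B.phi (q * x))) \<longlongrightarrow>
      - (b 6 * q) * ((1 - b 1 * ?x1) * (1 - b 4 * ?x1)) * 0 + b 6 * ((1 - b 2 * ?x1) * (1 - b 3 * ?x1)) * 0) (at ?x1)"
  proof (intro tendsto_add tendsto_mult tendsto_const tendsto_diff tendsto_ident_at)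
    show "((\<lambda>x. (x - ?x1) * A.phi x) \<longlongrightarrow> 0) (at ?x1)"
      unfolding A.phi_def using A.tendsto_mult_cauchy_at[OF x1 weight_pole(1)] .
    have "((\<lambda>y. (y - q * ?x1) * B.phi y) \<longlongrightarrow> 0) (at (q * ?x1))"
      unfolding B.phi_def using x1 A.q_nz by (intro B.tendsto_mult_cauchy_at weight_pole(2)) auto
    moreover have "filterlim (\<lambda>x. q * x) (at (q * ?x1)) (at ?x1)"
      by (rule filterlim_scale_at[OF A.q_nz])
    ultimately show "((\<lambda>x. (q * x - q * ?x1) * B.phi (q * x)) \<longlongrightarrow> 0) (at ?x1)"
      by (rule filterlim_compose)
  qed
  moreover have "eventually (\<lambda>x. - (b 6 * q) * ((1 - b 1 * x) * (1 - b 4 * x)) * ((x - ?x1) * A.phi x)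
      + b 6 * ((1 - b 2 * x) * (1 - b 3 * x)) * ((q * x - q * ?x1) * B.phi (q * x)) = ?Z x) (at ?x1)"
    using eventually_ok_at[OF x1]
  proof eventually_elim
    case (elim x)
    show ?case unfolding Z[OF elim, symmetric] using A.b6_nz by (simp add: field_simps)
  qed
  ultimately have "(?Z \<longlongrightarrow> 0) (at ?x1)"
    using Lim_transform_eventually by fastforce
  moreover have "polyfun ?Z" by (intro polyfun_intros)
  then obtain Zp where Zp: "\<And>x. ?Z x = poly Zp x" unfolding polyfun_def by blast
  ultimately have "(poly Zp \<longlongrightarrow> 0) (at ?x1)" by simp
  moreover have "(poly Zp \<longlongrightarrow> poly Zp ?x1) (at ?x1)"
    unfolding isCont_def[symmetric] by simp
  ultimately have "poly Zp ?x1 = 0"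
    using tendsto_unique[of "at ?x1"] by force
  then obtain Q where Q: "Zp = [:- ?x1, 1:] * Q" by (auto simp: poly_eq_0_iff_dvd dvd_def)
  \<comment> \<open>The constant comes from
    \<open>q * (t - b 6 * x) = - (q * b 6) * (x - t / b 6)\<close>.\<close>
  define K where "K = smult (- 1 / (q * b 6)) Q"
  have K: "q * (t - b 6 * x) * poly K x = ?Z x" for x
    unfolding Zp Q K_def using A.q_nz A.b6_nz by (simp add: field_simps)
  have "?F x = poly K x" if "ok x" for x
  proof -
    have "q * (t - b 6 * x) * ?F x = q * (t - b 6 * x) * poly K x" using Z[OF that] K[of x] by simp
    moreover have "q * (t - b 6 * x) \<noteq> 0" using that A.q_nz A.b6_nz by (auto simp: ok_def field_simps)
    ultimately show ?thesis by (metis mult_left_cancel)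
  qed
  moreover have "t * (poly K 0 * q) = t * (- ((q - 1) * poly T 0))"
    using K[of 0] by (simp add: algebra_simps)
  hence "poly K 0 * q = - ((q - 1) * poly T 0)"
    using A.t_nz by (simp only: mult_cancel_left) simp
  ultimately show ?thesis by blast
qed

definition K where "K = (SOME K. (\<forall>x. ok x \<longrightarrow>
    (1 - b 1 * x) * (1 - b 4 * x) * A.phi x - (1 - b 2 * x) * (1 - b 3 * x) * B.phi (q * x) = poly K x)
     \<and> poly K 0 * q = - ((q - 1) * poly T 0))"

lemma K: "ok x \<Longrightarrow> (1 - b 1 * x) * (1 - b 4 * x) * A.phi x - (1 - b 2 * x) * (1 - b 3 * x) * B.phi (q * x) = poly K x"
  and K_0: "poly K 0 * q = - ((q - 1) * poly T 0)"
  using someI_ex[OF ex_kernel_poly, folded K_def] by blast+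

text \<open>The Casoratian of the columns at \<open>(x, t)\<close> and \<open>(q x, q t)\<close>,
  with \<open>phi\<close> eliminated through \<open>K\<close> so that it makes sense for every
  \<open>x\<close>.\<close>

definition H where
  "H x = pn' (q * x) * pn x * poly K x - (1 - b 1 * x) * (1 - b 4 * x) * pn' (q * x) * rn x
     + (1 - b 2 * x) * (1 - b 3 * x) * rn' (q * x) * pn x"

lemma polyfun_H: "polyfun H"
  unfolding H_def by (intro polyfun_intros)

lemma H_eq:
  assumes "ok x"
  shows "H x = (1 - b 1 * x) * (1 - b 4 * x) * pn' (q * x) * sn x - (1 - b 2 * x) * (1 - b 3 * x) * sn' (q * x) * pn x"
proof -
  have "A.good x" "B.good (q * x)" using assms by (auto simp: ok_def)
  thus ?thesis
    unfolding H_def K[OF assms, symmetric] by (simp add: A.second_good B.second_good algebra_simps)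
qed

definition h1 where "h1 = b 1 * b 4 * q ^ n * lc' / lc - b 2 * b 3 / q ^ Suc n * lc / lc'"

text \<open>Each product in the Casoratian has order \<open>2 + n - (n + 1) = 1\<close> at infinity,
  and \<open>h1\<close> is the difference of their leading coefficients.\<close>

lemma H_linear: "H x = H 0 + h1 * x"
proof -
  let ?F = "\<lambda>x. ((1 + (- b 1) * x) / x) * ((1 + (- b 4) * x) / x) * (pn' (q * x) / x ^ n) * (x ^ Suc n * sn x)
    - ((1 + (- b 2) * x) / x) * ((1 + (- b 3) * x) / x) * (x ^ Suc n * sn' (q * x)) * (pn x / x ^ n)"
  have "(?F \<longlongrightarrow> (- b 1) * (- b 4) * (lc' * q ^ n) * (1 / lc)
      - (- b 2) * (- b 3) * (1 / (lc' * q ^ Suc n)) * lc) at_infinity"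
    by (intro tendsto_diff tendsto_mult tendsto_linear_at_infinity A.tendsto_second B.tendsto_second_scaled
        A.tendsto_p B.tendsto_p_scaled A.q_nz)
  moreover have "eventually (\<lambda>x. ?F x = H x / x ^ 1) at_infinity"
    using eventually_ok_at_infinity
  proof eventually_elim
    case (elim x)
    hence "x \<noteq> 0" by (auto simp: ok_def A.good_def)
    thus ?case unfolding H_eq[OF elim] by (simp add: field_simps)
  qed
  ultimately have "((\<lambda>x. H x / x ^ 1) \<longlongrightarrow> h1) at_infinity"
    by (rule Lim_transform_eventually[THEN tendsto_eq_rhs]) (simp add: h1_def mult_ac)
  then obtain P where P: "degree P \<le> 1" "coeff P 1 = h1" "\<forall>x. H x = poly P x"
    using polyfun_tendsto_coeff[OF polyfun_H, of 1] by blast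
  have "poly P x = coeff P 0 + coeff P 1 * x" for x
    using poly_as_sum_le[OF P(1)] by simp
  thus ?thesis using P by simp
qed

text \<open>The constant value of the Casoratian of the columns at \<open>(x, t)\<close> and
  \<open>(x, q t)\<close>, read off at infinity.\<close>

definition pd where "pd = b 6 * lc / lc' - lc' / (b 6 * lc)"

text \<open>\<open>E_plus\<close> and \<open>E_minus\<close> are linear, while \<open>p' * s\<close>
  and \<open>p * s'\<close> are of order \<open>1 / x\<close>, so the Casoratian is a polynomial
  with a limit at infinity. The form without \<open>s\<close> remains available at 0.\<close>

lemma pd_eq_poly:
  "pn' x * pn x * (- (q - 1) * t * poly T x) - E_plus q b x t * pn' x * rn x + E_minus q b x t * rn' x * pn x = pd"
    (is "?Pd x = pd")
  and pd_eq: "A.good x \<Longrightarrow> B.good x \<Longrightarrow> E_plus q b x t * pn' x * sn x - E_minus q b x t * sn' x * pn x = pd"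
proof -
  have eq: "E_plus q b x t * pn' x * sn x - E_minus q b x t * sn' x * pn x = ?Pd x"
    if "A.good x" "B.good x" for x
    using phi_deformation[OF that] that by (simp add: A.second_good B.second_good) algebra
  let ?F = "\<lambda>x. inverse (b 6) * ((b 6 * q * t + (- 1) * x) / x) * (pn' x / x ^ n) * (x ^ Suc n * sn x)
    - ((q * t + (- b 6) * x) / x) * (x ^ Suc n * sn' x) * (pn x / x ^ n)"
  have "(?F \<longlongrightarrow> inverse (b 6) * (- 1) * lc' * (1 / lc) - (- b 6) * (1 / lc') * lc) at_infinity"
    by (intro tendsto_diff tendsto_mult tendsto_const tendsto_linear_at_infinity A.tendsto_second B.tendsto_second
        A.tendsto_p B.tendsto_p)
  moreover have "eventually (\<lambda>x. ?F x = ?Pd x / x ^ 0) at_infinity"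
    using eventually_ok_at_infinity
  proof eventually_elim
    case (elim x)
    hence "x \<noteq> 0" and g: "A.good x" "B.good x" by (auto simp: ok_def A.good_def)
    thus ?case unfolding eq[OF g, symmetric] by (simp add: E_plus_def E_minus_def mult_ac)
  qed
  ultimately have "((\<lambda>x. ?Pd x / x ^ 0) \<longlongrightarrow> pd) at_infinity"
    by (rule Lim_transform_eventually[THEN tendsto_eq_rhs]) (simp add: pd_def field_simps)
  moreover have "polyfun ?Pd" by (intro polyfun_intros polyfun_D_E)
  ultimately obtain P where P: "degree P \<le> 0" "coeff P 0 = pd" "\<forall>x. ?Pd x = poly P x"
    using polyfun_tendsto_coeff[of ?Pd 0] by blast
  obtain a where "P = [:a:]" using P(1) degree_eq_zeroE by blast
  hence Pd: "?Pd x = pd" for x using P by simp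
  show "?Pd x = pd" by (rule Pd)
  show "E_plus q b x t * pn' x * sn x - E_minus q b x t * sn' x * pn x = pd" if "A.good x" "B.good x"
    using eq[OF that] Pd by simp
qed

text \<open>At 0 the points \<open>x\<close> and \<open>q * x\<close> coincide, so the two
  Casoratians differ only by the common value \<open>q * t\<close> of \<open>E_plus\<close> and
  \<open>E_minus\<close> there.\<close>

lemma H_0: "q * t * H 0 = pd"
proof -
  have "E_plus q b 0 t = q * t" "E_minus q b 0 t = q * t"
    using A.b6_nz by (simp_all add: E_plus_def E_minus_def)
  thus ?thesis
    using pd_eq_poly[of 0] K_0 unfolding H_def by simp algebra
qed

text \<open>The first component of the Pluecker relation for three vectors in a plane, with the
  Casoratians in their scaled forms. The second components occur only in the verification, which
  therefore takes place off the nodes.\<close>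

lemma three_term:
  "b 6 * pd * (1 - b 2 * x) * (1 - b 3 * x) * pn x - q * b 6 * (t - b 6 * x) * H x * pn (q * x)
    + q * A.c * poly Tp x * pn' (q * x) = 0"
proof -
  have "\<forall>x. b 6 * pd * (1 - b 2 * x) * (1 - b 3 * x) * pn x - q * b 6 * (t - b 6 * x) * H x * pn (q * x)
    + q * A.c * poly Tp x * pn' (q * x) = 0"
  proof (rule polyfun_eq_at[where z = 1])
    have "eventually ok (at 1)" by (rule eventually_ok_at) auto
    thus "eventually (\<lambda>x. b 6 * pd * (1 - b 2 * x) * (1 - b 3 * x) * pn x - q * b 6 * (t - b 6 * x) * H x * pn (q * x)
      + q * A.c * poly Tp x * pn' (q * x) = 0) (at 1)"
    proof eventually_elim
      case (elim x)
      hence g: "A.good x" "A.good (q * x)" "B.good (q * x)" by (auto simp: ok_def)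
      have cT: "A.c * poly Tp x = D_plus b x t * pn (q * x) * sn x - D_minus b x t * sn (q * x) * pn x"
        using A.p_spectral[of x] A.second_spectral(1)[OF g(1,2)] A.casorati_second[OF g(1)] by algebra
      have bpd: "b 6 * pd = q * (b 6 * t - x) * pn' (q * x) * sn (q * x) - b 6 * (q * (t - b 6 * x)) * sn' (q * x) * pn (q * x)"
        unfolding pd_eq[OF g(2,3), symmetric] E_plus_scaled[symmetric] E_minus_scaled[symmetric]
        by (simp add: algebra_simps)
      show ?case
        unfolding mult.assoc[of q A.c] cT bpd H_eq[OF elim] D_plus_def D_minus_def by algebra
    qed
  qed (intro polyfun_intros polyfun_comp[OF polyfun_H] polyfun_H)+
  thus ?thesis by blast
qed

text \<open>The spectral matrix at \<open>q * t\<close> expands the column at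
  \<open>(q x, q t)\<close> in data at \<open>(x, q t)\<close>, which turns \<open>H\<close> into
  \<open>pd\<close> and its analogue \<open>Z\<close> of index \<open>n - 1\<close>. Nothing about
  \<open>Z\<close> has to be known, since its coefficient vanishes at the root of
  \<open>Tp'\<close>, the point where \<open>f\<close> is defined.\<close>

lemma hat_relation:
  "\<exists>Z. \<forall>x. (q * t - b 6 * x) * (b 6 * q * t - x) * H x = poly Wp' x * pd - poly Tp' x * poly Z x"
proof -
  let ?Z = "\<lambda>x. pn1' x * pn x * (- (q - 1) * t * poly T x) - E_plus q b x t * pn1' x * rn x + E_minus q b x t * rn1' x * pn x"
  have "\<forall>x. (q * t - b 6 * x) * (b 6 * q * t - x) * H x = poly Wp' x * pd - poly Tp' x * ?Z x"
  proof (rule polyfun_eq_at[where z = 1])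
    have "eventually ok (at 1)" by (rule eventually_ok_at) auto
    thus "eventually (\<lambda>x. (q * t - b 6 * x) * (b 6 * q * t - x) * H x = poly Wp' x * pd - poly Tp' x * ?Z x) (at 1)"
    proof eventually_elim
      case (elim x)
      hence g: "A.good x" "B.good x" "B.good (q * x)" by (auto simp: ok_def)
      have Z: "?Z x = E_plus q b x t * pn1' x * sn x - E_minus q b x t * sn1' x * pn x"
        using phi_deformation[OF g(1,2)] g by (simp add: A.second_good B.second_good) algebra
      have "b 6 * ((q * t - b 6 * x) * (b 6 * q * t - x) * H x) =
          b 6 * (E_plus q b x t * sn x * (D_plus b x (q * t) * pn' (q * x)) - E_minus q b x t * pn x * (D_minus b x (q * t) * sn' (q * x)))"
        unfolding H_eq[OF elim] D_plus_def D_minus_def E_plus_def E_minus_def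
        using A.b6_nz by (simp add: field_simps)
      also have "\<dots> = b 6 * (poly Wp' x * pd - poly Tp' x * ?Z x)"
        unfolding Z B.p_spectral B.second_spectral(1)[OF g(2,3)] pd_eq[OF g(1,2), symmetric] by algebra
      finally show ?case using A.b6_nz by simp
    qed
  qed (intro polyfun_intros polyfun_D_E polyfun_H)+
  moreover have "polyfun ?Z" by (intro polyfun_intros polyfun_D_E)
  ultimately show ?thesis unfolding polyfun_def by metis
qed

text \<open>The companion of \<open>hat_relation\<close>: the column at \<open>(x, t)\<close> is
  expanded at \<open>(q x, t)\<close> by the inverse matrix, so a root of \<open>Tp\<close> yields
  the value of \<open>Wm\<close>.\<close>

lemma inverse_relation:
  "\<exists>Z. \<forall>x. q * (t - b 6 * x) * (b 6 * t - x) * H x = poly Wm x * pd + poly Tp x * poly Z x"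
proof -
  let ?Z = "\<lambda>x. pn' x * pn1 x * (- (q - 1) * t * poly T x) - E_plus q b x t * pn' x * rn1 x + E_minus q b x t * rn' x * pn1 x"
  have "\<forall>x. q * (t - b 6 * x) * (b 6 * t - x) * H x = poly Wm x * pd + poly Tp x * ?Z (q * x)"
  proof (rule polyfun_eq_at[where z = 1])
    have "eventually ok (at 1)" by (rule eventually_ok_at) auto
    thus "eventually (\<lambda>x. q * (t - b 6 * x) * (b 6 * t - x) * H x = poly Wm x * pd + poly Tp x * ?Z (q * x)) (at 1)"
      using A.D_nz(2)
    proof eventually_elim
      case (elim x)
      hence g: "A.good x" "A.good (q * x)" "B.good (q * x)" by (auto simp: ok_def)
      have Z: "?Z (q * x) = E_plus q b (q * x) t * pn' (q * x) * sn1 (q * x) - E_minus q b (q * x) t * sn' (q * x) * pn1 (q * x)"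
        using phi_deformation[OF g(2,3)] g by (simp add: A.second_good B.second_good) algebra
      have "b 6 * (q * (t - b 6 * x) * (b 6 * t - x) * H x) =
          b 6 * E_plus q b (q * x) t * pn' (q * x) * (D_plus b x t * sn x) - b 6 * E_minus q b (q * x) t * sn' (q * x) * (D_minus b x t * pn x)"
        unfolding H_eq[OF elim(1)] D_plus_def D_minus_def E_plus_scaled E_minus_scaled by algebra
      also have "\<dots> = b 6 * (poly Wm x * pd + poly Tp x * ?Z (q * x))"
        unfolding Z A.p_inverse A.second_inverse[OF g(1,2) elim(2)] pd_eq[OF g(2,3), symmetric] by algebra
      finally show ?case using A.b6_nz by simp
    qed
  qed (intro polyfun_intros polyfun_D_E polyfun_H)+
  moreover have "polyfun (\<lambda>x. ?Z (q * x))" by (intro polyfun_intros polyfun_D_E)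
  ultimately show ?thesis unfolding polyfun_def by metis
qed

end

subsection \<open>The variables f and g\<close>

lemma quadratic_from_root:
  fixes P L :: "complex poly"
  assumes "P = [:0, 1:] * L" "degree L = 1" "poly L g = 0"
  shows "coeff P 2 \<noteq> 0" "poly P x = coeff P 2 * x * (x - g)"
proof -
  have L: "poly L y = coeff L 0 + coeff L 1 * y" for y
    using poly_as_sum_le[of L 1 y] assms(2) by simp
  have "coeff L 1 \<noteq> 0" using assms(2) by (metis degree_0 leading_coeff_0_iff zero_neq_one)
  moreover have c: "coeff P 2 = coeff L 1" unfolding assms(1) by (simp add: numeral_2_eq_2)
  ultimately show "coeff P 2 \<noteq> 0" by simp
  have "coeff L 0 = - (coeff L 1 * g)" using assms(3) L[of g] by (simp add: eq_neg_iff_add_eq_0)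
  thus "poly P x = coeff P 2 * x * (x - g)"
    unfolding c unfolding assms(1) by (simp add: L algebra_simps)
qed

text \<open>A comparison of partial fractions in \<open>x\<close>. \<open>e1, e2, e3\<close> are to
  be the elementary symmetric functions of \<open>b 1, ..., b 4\<close>, whose product is 1;
  \<open>u, v\<close> and \<open>u', v'\<close> are the middle coefficients of \<open>Wp\<close> and
  \<open>Wm\<close>, about which only \<open>u + u'\<close> and the values at \<open>g\<close> give
  information.\<close>

lemma second_order_coefficient:
  fixes x g f t q b5 b6 e1 e2 e3 u v u' v' Wg Wg' :: complex
  assumes nz: "x \<noteq> 0" "x \<noteq> g" "x \<noteq> q * g" "1 - f * x \<noteq> 0" "1 - f * g \<noteq> 0" "f \<noteq> 0" "g \<noteq> 0" "t \<noteq> 0"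
      "q \<noteq> 0" "b5 \<noteq> 0" "b6 \<noteq> 0"
    and Wg: "b6 * t + u * g + v * g ^ 2 + (- (b6 * b5)) * g ^ 3 = Wg"
      "Wg * (1 - f * g) = b6 * t * (1 - e1 * g + e2 * g ^ 2 - e3 * g ^ 3 + g ^ 4)"
    and Wg': "b6 * t + u' * g + v' * g ^ 2 + (- (b6 / b5)) * g ^ 3 = Wg'"
      "t * Wg' = (t - b6 * g) * (b6 * t - g) * (1 - f * g)"
    and uu: "u + u' = - (b6 * t * e1 + b6 ^ 2 + 1)"
  shows "(b6 * t + u * x + v * x ^ 2 + (- (b6 * b5)) * x ^ 3) / (x * (x - g))
      + q ^ 2 * (b6 * t + u' * (x / q) + v' * (x / q) ^ 2 + (- (b6 / b5)) * (x / q) ^ 3) / (x * (x - q * g))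
    = - (b6 * t) * (- (1 - e1 * x + e2 * x ^ 2 - e3 * x ^ 3 + x ^ 4) / (x * (x - g) * (1 - f * x))
        + x * (f ^ 4 - e1 * f ^ 3 + e2 * f ^ 2 - e3 * f + 1) / (f * (1 - f * g) * (1 - f * x))
        - x * (f - b5 * q * t) * (b5 * f - t) / (b5 * q * t ^ 2 * f)
        - (x - b6 * q * t) * (b6 * x - q * t) * (q - f * x) / (b6 * q * t ^ 2 * x * (x - q * g)))"
proof -
  define w where "w = - (b6 * b5)"
  define w' where "w' = - (b6 / b5)"
  define Q where "Q = 1 - e1 * g + e2 * g ^ 2 - e3 * g ^ 3 + g ^ 4"
  define Qf where "Qf = f ^ 4 - e1 * f ^ 3 + e2 * f ^ 2 - e3 * f + 1"
  \<comment> \<open>\<open>B1\<close> and \<open>B4\<close> are the constant terms in the partial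
    fractions of the first two summands of the bracket and of its last summand, taken with its minus
    sign.\<close>
  define B1 where "B1 = (g + 1 / f - e3) / f - Qf / (f ^ 2 * (1 - f * g))"
  define B4 where "B4 = - 1 / t ^ 2 - f * (1 + b6 ^ 2) / (b6 * t) + f * g / t ^ 2"
  have nz': "x - g \<noteq> 0" "x - q * g \<noteq> 0" using nz by auto
  have pf1: "(b6 * t + u * x + v * x ^ 2 + w * x ^ 3) / (x * (x - g)) =
      Wg / (g * (x - g)) - b6 * t / (g * x) + w * x + (v + w * g)"
    unfolding Wg(1)[folded w_def, symmetric] using nz nz'(1) by (simp add: divide_simps) algebra
  have pf2: "q ^ 2 * (b6 * t + u' * (x / q) + v' * (x / q) ^ 2 + w' * (x / q) ^ 3) / (x * (x - q * g)) =
      q * Wg' / (g * (x - q * g)) - q * b6 * t / (g * x) + w' * x / q + (v' + w' * g)"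
    unfolding Wg'(1)[folded w'_def, symmetric] using nz nz'(2) by (simp add: divide_simps) algebra
  \<comment> \<open>The residues of the two summands at \<open>x = 1 / f\<close> are opposite, so no
    pole is left there.\<close>
  have pf3: "- (1 - e1 * x + e2 * x ^ 2 - e3 * x ^ 3 + x ^ 4) / (x * (x - g) * (1 - f * x))
        + x * Qf / (f * (1 - f * g) * (1 - f * x)) =
      - Q / (g * (1 - f * g) * (x - g)) + 1 / (g * x) + x / f + B1"
    unfolding B1_def Q_def Qf_def using nz nz'(1) by (simp add: divide_simps) algebra
  have pf4: "(x - b6 * q * t) * (b6 * x - q * t) * (q - f * x) / (b6 * q * t ^ 2 * x * (x - q * g)) =
      q * (g - b6 * t) * (b6 * g - t) * (1 - f * g) / (b6 * t ^ 2 * g * (x - q * g)) - q / (g * x) - f * x / (q * t ^ 2) - B4"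
    unfolding B4_def using nz nz'(2) by (simp add: divide_simps) algebra
  have pf5: "x * (f - b5 * q * t) * (b5 * f - t) / (b5 * q * t ^ 2 * f) =
      f * x / (q * t ^ 2) - x / (b5 * q * t) - b5 * x / t + x / f"
    using nz by (simp add: divide_simps) algebra
  have res: "Wg = b6 * t * Q / (1 - f * g)" "Wg' = (t - b6 * g) * (b6 * t - g) * (1 - f * g) / t"
    using Wg(2) Wg'(2) nz unfolding Q_def by (simp_all add: field_simps)
  have "g ^ 2 * ((v + w * g) + (v' + w' * g)) = Wg + Wg' - 2 * (b6 * t) - (u + u') * g"
    unfolding Wg(1)[folded w_def, symmetric] Wg'(1)[folded w'_def, symmetric] by algebra
  also have "\<dots> = g ^ 2 * (- (b6 * t) * (B1 + B4))"
  proof -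
    have "g ^ 2 * B1 = - (Q / (1 - f * g) - 1 - f * g + e1 * g)"
      unfolding B1_def Q_def Qf_def using nz(5,6) by (simp add: divide_simps) algebra
    hence Q: "Q / (1 - f * g) = 1 + f * g - e1 * g - g ^ 2 * B1"
      by (simp add: algebra_simps)
    have 1: "Wg = b6 * t * (1 + f * g - e1 * g - g ^ 2 * B1)"
      unfolding res(1) Q[symmetric] by simp
    have 2: "Wg' = b6 * t - (1 + b6 ^ 2) * g - b6 * t * f * g - b6 * t * (g ^ 2 * B4)"
      unfolding res(2) B4_def using nz(8,11) by (simp add: divide_simps) algebra
    show ?thesis
      unfolding 1 2 uu by algebra
  qed
  finally have const: "(v + w * g) + (v' + w' * g) = - (b6 * t) * (B1 + B4)"
    using nz(7) by (simp only: mult_cancel_left) simp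
  \<comment> \<open>In the bracket \<open>x / f\<close> and \<open>f * x / (q * t ^ 2)\<close>
    cancel between \<open>pf3\<close>, \<open>pf4\<close> and \<open>pf5\<close>; the two terms on
    the right are the ones that survive.\<close>
  have lin: "w * x + w' * x / q = - (b6 * t) * (x / (b5 * q * t) + b5 * x / t)"
    unfolding w_def w'_def using nz by (simp add: field_simps)
  have r1: "Wg / (g * (x - g)) = - (b6 * t) * (- Q / (g * (1 - f * g) * (x - g)))"
    unfolding res by simp
  have r2: "q * Wg' / (g * (x - q * g)) = - (b6 * t) * (- (q * (g - b6 * t) * (b6 * g - t) * (1 - f * g) / (b6 * t ^ 2 * g * (x - q * g))))"
    unfolding res using nz nz'(2) by (simp add: divide_simps) algebra
  have r3: "b6 * t / (g * x) = (b6 * t) * (1 / (g * x))" "q * b6 * t / (g * x) = (b6 * t) * (q / (g * x))"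
    by simp_all
  have combine: "(- k * a - k * i + l + c) + (- k * (- d) - k * i' + l' + c') =
      - k * ((a + i + m + B) - (n - m1 - m2 + m) - (d - i' - n - B'))"
    if "c + c' = - k * (B + B')" "l + l' = - k * (m1 + m2)"
    for k a i l c d i' l' c' m B n m1 m2 B' :: complex
    using that by algebra
  show ?thesis
    unfolding w_def[symmetric] w'_def[symmetric] Qf_def[symmetric]
    unfolding pf1 pf2 pf3 pf4 pf5 r1 r2 r3
    by (rule combine[OF const lin])
qed

context lax_pair begin

text \<open>If \<open>pd = 0\<close>, then \<open>H\<close> is a multiple of \<open>x\<close>, and
  the three-term relation equates \<open>(x - g) * p'(q x)\<close> and
  \<open>(t - b 6 * x) * p(q x)\<close> up to constants, while \<open>p\<close> divides
  \<open>E_plus * p'\<close>. At \<open>x = g\<close> neither \<open>t - b 6 * x\<close> nor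
  \<open>E_plus\<close> at \<open>q * x\<close> vanishes, which forces \<open>h1 = 0\<close> and
  then \<open>p' = 0\<close>.\<close>

lemma pd_nonzero:
  assumes tau: "tau \<noteq> 0" and Tp: "\<And>x. poly Tp x = tau * x * (x - g)"
    and g: "g \<noteq> b 6 * t" "b 6 * g \<noteq> t"
  shows "pd \<noteq> 0"
proof
  assume pd: "pd = 0"
  hence "H 0 = 0" using H_0 A.q_nz A.t_nz by simp
  hence H: "H x = h1 * x" for x using H_linear[of x] by simp
  have lin: "A.c * tau * (x - g) * pn' (q * x) = b 6 * h1 * (t - b 6 * x) * pn (q * x)" if "x \<noteq> 0" for x
  proof -
    have "(q * x) * (A.c * tau * (x - g) * pn' (q * x)) = (q * x) * (b 6 * h1 * (t - b 6 * x) * pn (q * x))"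
      using three_term[of x] unfolding pd H Tp by (simp add: algebra_simps)
    moreover have "q * x \<noteq> 0" using that A.q_nz by simp
    ultimately show ?thesis by (metis mult_left_cancel)
  qed
  let ?k = "\<lambda>x. pn1 x * (pn' x * (- (q - 1) * t * poly T x) + E_minus q b x t * rn' x) - E_plus q b x t * pn' x * rn1 x"
  \<comment> \<open>\<open>p\<close> and \<open>r\<close> are coprime because
    \<open>p_(n-1) * r_n - p_n * r_(n-1) = c\<close>. With \<open>pd = 0\<close>, \<open>p\<close>
    divides \<open>E_plus * p' * r\<close>, hence \<open>E_plus * p'\<close>; \<open>?k\<close> is
    the quotient up to \<open>c\<close>.\<close>
  have k: "A.c * E_plus q b x t * pn' x = pn x * ?k x" for x
    using pd_eq_poly[of x] A.casorati_n[of x] unfolding pd by algebra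
  have p'_nz: "eventually (\<lambda>x. pn' (q * x) \<noteq> 0) (at 1)"
  proof -
    have "p' n \<noteq> 0" using B.lead_coeff_p_nonzero[of n] by auto
    then obtain z where "pn' z \<noteq> 0" using poly_all_0_iff_0 by blast
    hence "eventually (\<lambda>x. pn' x \<noteq> 0) (at (q * 1))"
      by (intro polyfun_eventually_nonzero polyfun_poly)
    thus ?thesis by (intro eventually_at_scale A.q_nz)
  qed
  have x_nz: "eventually (\<lambda>x. x \<noteq> 0) (at (1::complex))"
    by (rule eventually_neq_at_within)
  have "\<forall>x. A.c * E_plus q b (q * x) t * (b 6 * h1 * (t - b 6 * x)) = A.c * tau * (x - g) * ?k (q * x)"
  proof (rule polyfun_eq_at[where z = 1])
    show "eventually (\<lambda>x. A.c * E_plus q b (q * x) t * (b 6 * h1 * (t - b 6 * x)) = A.c * tau * (x - g) * ?k (q * x)) (at 1)"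
      using p'_nz x_nz
    proof eventually_elim
      case (elim x)
      have "pn' (q * x) * (A.c * E_plus q b (q * x) t * (b 6 * h1 * (t - b 6 * x))) =
          pn' (q * x) * (A.c * tau * (x - g) * ?k (q * x))"
        using k[of "q * x"] lin[OF elim(2)] by algebra
      thus ?case using elim(1) by (simp only: mult_cancel_left) simp
    qed
  qed (intro polyfun_intros polyfun_D_E)+
  from this[rule_format, of g] have "A.c * E_plus q b (q * g) t * (b 6 * h1 * (t - b 6 * g)) = 0" by simp
  moreover have "E_plus q b (q * g) t \<noteq> 0"
    using E_plus_scaled[of g] g A.q_nz by auto
  ultimately have "h1 = 0" using A.c_nz A.b6_nz g(2) by auto
  have "eventually (\<lambda>x. x \<noteq> g) (at (1::complex))" by (rule eventually_neq_at_within)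
  with p'_nz x_nz have "eventually (\<lambda>_. False) (at (1::complex))"
  proof eventually_elim
    case (elim x)
    thus ?case using lin[of x] \<open>h1 = 0\<close> tau A.c_nz by auto
  qed
  thus False by simp
qed

text \<open>A linear function is determined by its values at 0 and \<open>g'\<close>. The value at
  \<open>g'\<close> comes from \<open>hat_relation\<close>, whose two explicit factors are those in
  the definition of \<open>f\<close>.\<close>

lemma H_from_f:
  assumes "pd \<noteq> 0" and Tp': "poly Tp' g' = 0"
    and f: "poly Wp' g' = - (1 / (q * t)) * (g' - b 6 * (q * t)) * (b 6 * g' - q * t) * (f * g' - 1)"
    and g': "g' \<noteq> 0" "g' \<noteq> b 6 * (q * t)" "b 6 * g' \<noteq> q * t"
  shows "q * t * H x = pd * (1 - f * x)" and "q * t * h1 = - (pd * f)"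
proof -
  obtain Z where Z: "(q * t - b 6 * g') * (b 6 * q * t - g') * H g' = poly Wp' g' * pd - poly Tp' g' * poly Z g'"
    using hat_relation by blast
  have "((q * t - b 6 * g') * (b 6 * (q * t) - g')) * (q * t * H g') = (q * t) * poly Wp' g' * pd"
    using Z Tp' by algebra
  also have "(q * t) * poly Wp' g' = - ((g' - b 6 * (q * t)) * (b 6 * g' - q * t) * (f * g' - 1))"
    unfolding f using A.q_nz A.t_nz by simp
  also have "- ((g' - b 6 * (q * t)) * (b 6 * g' - q * t) * (f * g' - 1)) * pd =
      ((q * t - b 6 * g') * (b 6 * (q * t) - g')) * (pd * (1 - f * g'))"
    by algebra
  finally have "q * t * H g' = pd * (1 - f * g')" using g' by simp
  hence "g' * (q * t * h1) = g' * (- (pd * f))"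
    using H_linear[of g'] H_0 by algebra
  thus h1: "q * t * h1 = - (pd * f)" using g' by (simp only: mult_cancel_left) simp
  show "q * t * H x = pd * (1 - f * x)"
    using H_linear[of x] H_0 h1 by algebra
qed

text \<open>\<open>h1\<close> and \<open>pd\<close> are combinations of \<open>lc / lc'\<close> and
  \<open>lc' / lc\<close>. In \<open>pd * (f - b 5 * q * t)\<close> the second ratio cancels because
  \<open>b 5 / b 6 = b 1 * b 4 * q ^ n\<close>, and the leading coefficient of \<open>Tp\<close>
  remains. This is the origin of the equation for \<open>C\<close>.\<close>

lemma gauge_constant:
  assumes h1: "q * t * h1 = - (pd * f)" and b5: "b 5 = b 1 * b 4 * b 6 * q ^ n"
  shows "A.c * coeff Tp 2 * (q * t) * (lc / lc') = pd * (f - b 5 * q * t)"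
proof -
  have lcs: "lc \<noteq> 0" "lc' \<noteq> 0" using A.lead_coeff_p_nonzero B.lead_coeff_p_nonzero by auto
  have "pd * (f - b 5 * q * t) = - (q * t * h1) - pd * b 5 * q * t"
    unfolding h1 by (simp add: algebra_simps)
  also have "\<dots> = (b 2 * b 3 / q ^ Suc n - b 6 ^ 2 * b 1 * b 4 * q ^ n) * (q * t) * (lc / lc')"
    unfolding h1_def pd_def b5 using lcs A.b6_nz A.q_nz by (simp add: field_simps power2_eq_square)
  finally show ?thesis using A.Tp_lead by (simp only:)
qed

lemma Wm_at_root:
  assumes "pd \<noteq> 0" "poly Tp g = 0" and H: "q * t * H g = pd * (1 - f * g)"
  shows "t * poly Wm g = (t - b 6 * g) * (b 6 * t - g) * (1 - f * g)"
proof -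
  obtain Z where Z: "q * (t - b 6 * g) * (b 6 * t - g) * H g = poly Wm g * pd + poly Tp g * poly Z g"
    using inverse_relation by blast
  have "pd * (t * poly Wm g) = (t - b 6 * g) * (b 6 * t - g) * (q * t * H g)"
    using Z assms(2) by algebra
  hence "pd * (t * poly Wm g) = pd * ((t - b 6 * g) * (b 6 * t - g) * (1 - f * g))"
    unfolding H by (simp add: mult_ac)
  thus ?thesis using assms(1) by (simp only: mult_cancel_left) simp
qed

text \<open>At a root of \<open>Tp\<close> the determinant reduces to \<open>Wp * Wm\<close>, and
  \<open>Wm\<close> shares two nonzero factors with \<open>D_plus * D_minus\<close>.\<close>

lemma Wp_at_root:
  assumes Tp: "poly Tp g = 0" and Wm: "t * poly Wm g = (t - b 6 * g) * (b 6 * t - g) * (1 - f * g)"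
    and g: "g \<noteq> b 6 * t" "b 6 * g \<noteq> t"
  shows "poly Wp g * (1 - f * g) = b 6 * t * ((1 - b 1 * g) * (1 - b 2 * g) * (1 - b 3 * g) * (1 - b 4 * g))"
proof -
  have "((t - b 6 * g) * (b 6 * t - g)) * (poly Wp g * (1 - f * g)) = t * (poly Wp g * poly Wm g + poly Tp g * poly Tm g)"
    using Wm Tp by algebra
  also have "\<dots> = ((t - b 6 * g) * (b 6 * t - g)) *
      (b 6 * t * ((1 - b 1 * g) * (1 - b 2 * g) * (1 - b 3 * g) * (1 - b 4 * g)))"
    unfolding A.det_spectral D_plus_def D_minus_def by algebra
  finally show ?thesis using g by (simp only: mult_cancel_left) simp
qed

end

subsection \<open>The concrete systems\<close>

lemma orthonormal_system_weight:
  assumes "norm q < 1" "orthonormal_polys q b G p t"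
  shows "orthonormal_system q (G t) (\<lambda>y. weight q b y t) (\<lambda>k. p k t)"
proof
  show "norm q < 1" by fact
  show "bounded ((\<lambda>y. weight q b y t) ` jackson_nodes q (G t))"
    by (rule bounded_image_nodes[OF assms(1) tendsto_weight_0[OF assms(1)]])
  have "\<forall>n. degree (p n t) = n \<and> lead_coeff (p n t) \<noteq> 0"
    "\<forall>n m. jackson q (G t) (\<lambda>x. weight q b x t * poly (p n t) x * poly (p m t) x) = (if n = m then 1 else 0)"
    using assms(2) unfolding orthonormal_polys_def by blast+
  thus "degree (p n t) = n" "lead_coeff (p n t) \<noteq> 0"
    "jackson q (G t) (\<lambda>x. weight q b x t * poly (p n t) x * poly (p m t) x) = (if n = m then 1 else 0)" for n m
    by blast+
qed

lemma spectral_matrix_entries: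
  assumes "spectral_matrix q b G p n t (vector [vector [W1, - T1], vector [T2, W2]])"
    and "x \<noteq> 0" "x \<notin> jackson_nodes q (G t)" "q * x \<notin> jackson_nodes q (G t)"
    and "weight_regular q b x t" "weight_regular q b (q * x) t"
  shows "D_plus b x t * poly (p n t) (q * x) = poly W1 x * poly (p n t) x - poly T1 x * poly (p (n - 1) t) x"
    and "D_plus b x t * poly (p (n - 1) t) (q * x) = poly T2 x * poly (p n t) x + poly W2 x * poly (p (n - 1) t) x"
    and "D_plus b x t * (second_kind q b G p n (q * x) t / weight q b (q * x) t) =
      poly W1 x * (second_kind q b G p n x t / weight q b x t) - poly T1 x * (second_kind q b G p (n - 1) x t / weight q b x t)"
    and "D_plus b x t * (second_kind q b G p (n - 1) (q * x) t / weight q b (q * x) t) =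
      poly T2 x * (second_kind q b G p n x t / weight q b x t) + poly W2 x * (second_kind q b G p (n - 1) x t / weight q b x t)"
proof -
  let ?A = "vector [vector [W1, - T1], vector [T2, W2]] :: complex poly^2^2"
  have "mat (D_plus b x t) ** Y_mat q b G p n (q * x) t = (\<chi> i j. poly (?A $ i $ j) x) ** Y_mat q b G p n x t"
    using assms unfolding spectral_matrix_def by blast
  hence "(mat (D_plus b x t) ** Y_mat q b G p n (q * x) t) $ i $ j =
      ((\<chi> i j. poly (?A $ i $ j) x) ** Y_mat q b G p n x t) $ i $ j" for i j by simp
  from this[of 1 1] this[of 2 1] this[of 1 2] this[of 2 2]
  show "D_plus b x t * poly (p n t) (q * x) = poly W1 x * poly (p n t) x - poly T1 x * poly (p (n - 1) t) x"
    and "D_plus b x t * poly (p (n - 1) t) (q * x) = poly T2 x * poly (p n t) x + poly W2 x * poly (p (n - 1) t) x"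
    and "D_plus b x t * (second_kind q b G p n (q * x) t / weight q b (q * x) t) =
      poly W1 x * (second_kind q b G p n x t / weight q b x t) - poly T1 x * (second_kind q b G p (n - 1) x t / weight q b x t)"
    and "D_plus b x t * (second_kind q b G p (n - 1) (q * x) t / weight q b (q * x) t) =
      poly T2 x * (second_kind q b G p n x t / weight q b x t) + poly W2 x * (second_kind q b G p (n - 1) x t / weight q b x t)"
    by (simp_all add: matrix_matrix_mult_def sum_2 mat_def Y_mat_def)
qed

text \<open>The matrix equation is given only at regular points off the nodes. The weight is regular
  near 0, where the nodes may accumulate, so the identities are checked around a small nonzero
  \<open>z\<close> and then extended to all \<open>x\<close>.\<close>

lemma ex_spectral_system:
  assumes q: "norm q < 1" "q \<noteq> 0" and n: "n \<ge> 1" and t: "t \<noteq> 0" and b6: "b 6 \<noteq> 0"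
    and spec: "stieltjes_spectral_eq q b G t" and orth: "orthonormal_polys q b G p t"
    and A: "spectral_matrix q b G p n t (vector [vector [Wp, - Tp], vector [Tm, Wm]])"
  shows "\<exists>S. spectral_system q (G t) (\<lambda>y. weight q b y t) (\<lambda>k. p k t) b t n S Wp Tp Tm Wm"
proof -
  interpret orthonormal_system q "G t" "\<lambda>y. weight q b y t" "\<lambda>k. p k t"
    by (rule orthonormal_system_weight[OF q(1) orth])
  have phi: "stieltjes q b G x t = phi x" for x
    by (simp add: stieltjes_def phi_def cauchy_def)
  have second: "second_kind q b G p k x t = second k x" for k x
    by (simp add: second_kind_def second_def cauchy_def)
  obtain S where S: "\<And>x. x \<noteq> 0 \<Longrightarrow> x \<notin> nodes \<Longrightarrow> q * x \<notin> nodes \<Longrightarrow>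
      D_minus b x t * phi (q * x) = D_plus b x t * phi x + (q - 1) * x * poly S x"
    using spec unfolding stieltjes_spectral_eq_def phi by blast
  obtain d where d: "d > 0" "\<And>x. norm x < d \<Longrightarrow> weight_regular q b x t"
    using eventually_weight_regular_0[OF q(1), of b t] unfolding eventually_nhds_metric by (auto simp: dist_norm)
  define z where "z = complex_of_real (d / 2)"
  have z: "z \<noteq> 0" "norm z < d" using d(1) by (auto simp: z_def)
  define reg where "reg x \<longleftrightarrow> good x \<and> good (q * x) \<and> weight_regular q b x t \<and> weight_regular q b (q * x) t" for x
  have reg: "eventually reg (at z)"
  proof -
    have "eventually (\<lambda>x. norm x < d) (at z)"
      using z(2) by (intro order_tendstoD(2)[of norm "norm z"] tendsto_norm tendsto_ident_at) auto
    moreover have "eventually good (at z)" "eventually (\<lambda>x. good (q * x)) (at z)"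
      using z(1) q(2) by (auto intro!: eventually_good_at eventually_at_scale)
    ultimately show ?thesis
    proof eventually_elim
      case (elim x)
      moreover have "norm (q * x) < d"
        using elim(1) q(1) mult_left_le_one_le[of "norm x" "norm q"] by (simp add: norm_mult)
      ultimately show ?case unfolding reg_def using d(2) by blast
    qed
  qed
  have g: "x \<noteq> 0" "x \<notin> nodes" "q * x \<notin> nodes" "weight_regular q b x t" "weight_regular q b (q * x) t"
      "good x" "good (q * x)" if "reg x" for x
    using that by (auto simp: reg_def good_def)
  have p1: "\<forall>x. D_plus b x t * poly (p n t) (q * x) = poly Wp x * poly (p n t) x - poly Tp x * poly (p (n - 1) t) x"
  proof (rule polyfun_eq_at)
    show "eventually (\<lambda>x. D_plus b x t * poly (p n t) (q * x) = poly Wp x * poly (p n t) x - poly Tp x * poly (p (n - 1) t) x) (at z)"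
      using reg by eventually_elim (use spectral_matrix_entries(1)[OF A] g in blast)
  qed (intro polyfun_intros polyfun_D_E)+
  have p2: "\<forall>x. D_plus b x t * poly (p (n - 1) t) (q * x) = poly Tm x * poly (p n t) x + poly Wm x * poly (p (n - 1) t) x"
  proof (rule polyfun_eq_at)
    show "eventually (\<lambda>x. D_plus b x t * poly (p (n - 1) t) (q * x) = poly Tm x * poly (p n t) x + poly Wm x * poly (p (n - 1) t) x) (at z)"
      using reg by eventually_elim (use spectral_matrix_entries(2)[OF A] g in blast)
  qed (intro polyfun_intros polyfun_D_E)+
  have clear: "D_minus b x t * s = u * s1 + v * s2"
    if "reg x" "D_plus b x t * (s / weight q b (q * x) t) = u * (s1 / weight q b x t) + v * (s2 / weight q b x t)"
    for x s u v s1 s2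
  proof -
    have nz: "weight q b x t \<noteq> 0" "weight q b (q * x) t \<noteq> 0"
      using g(4,5)[OF that(1), THEN weight_regular_nonzero] .
    have w: "D_minus b x t * weight q b (q * x) t = D_plus b x t * weight q b x t"
      by (rule weight_shift_x[OF q(1) g(4,5)[OF that(1)] b6 t])
    have "D_minus b x t * s * weight q b (q * x) t = (D_plus b x t * (s / weight q b (q * x) t)) * weight q b x t * weight q b (q * x) t"
      using nz w by (simp add: field_simps)
    also have "\<dots> = (u * s1 + v * s2) * weight q b (q * x) t"
      unfolding that(2) using nz by (simp add: field_simps)
    finally show ?thesis using nz by simp
  qed
  have r1: "\<forall>x. D_minus b x t * poly (assoc n) (q * x) - (q - 1) * x * poly S x * poly (p n t) (q * x) =
      poly Wp x * poly (assoc n) x - poly Tp x * poly (assoc (n - 1)) x"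
  proof (rule polyfun_eq_at)
    show "eventually (\<lambda>x. D_minus b x t * poly (assoc n) (q * x) - (q - 1) * x * poly S x * poly (p n t) (q * x) =
      poly Wp x * poly (assoc n) x - poly Tp x * poly (assoc (n - 1)) x) (at z)"
      using reg
    proof eventually_elim
      case (elim x)
      note g = g[OF elim]
      have "D_minus b x t * second n (q * x) = poly Wp x * second n x + (- poly Tp x) * second (n - 1) x"
        by (rule clear[OF elim])
          (use spectral_matrix_entries(3)[OF A g(1-5)] in \<open>simp add: second\<close>)
      thus ?case
        using p1[rule_format, of x] S[OF g(1-3)] unfolding second_good[OF g(6)] second_good[OF g(7)] by algebra
    qed
  qed (intro polyfun_intros polyfun_D_E)+
  have r2: "\<forall>x. D_minus b x t * poly (assoc (n - 1)) (q * x) - (q - 1) * x * poly S x * poly (p (n - 1) t) (q * x) =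
      poly Tm x * poly (assoc n) x + poly Wm x * poly (assoc (n - 1)) x"
  proof (rule polyfun_eq_at)
    show "eventually (\<lambda>x. D_minus b x t * poly (assoc (n - 1)) (q * x) - (q - 1) * x * poly S x * poly (p (n - 1) t) (q * x) =
      poly Tm x * poly (assoc n) x + poly Wm x * poly (assoc (n - 1)) x) (at z)"
      using reg
    proof eventually_elim
      case (elim x)
      note g = g[OF elim]
      have "D_minus b x t * second (n - 1) (q * x) = poly Tm x * second n x + poly Wm x * second (n - 1) x"
        by (rule clear[OF elim])
          (use spectral_matrix_entries(4)[OF A g(1-5)] in \<open>simp add: second\<close>)
      thus ?case
        using p2[rule_format, of x] S[OF g(1-3)] unfolding second_good[OF g(6)] second_good[OF g(7)] by algebra
    qed
  qed (intro polyfun_intros polyfun_D_E)+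
  show ?thesis
  proof (intro exI[of _ S] spectral_system.intro spectral_system_axioms.intro)
    show "orthonormal_system q (G t) (\<lambda>y. weight q b y t) (\<lambda>k. p k t)" by unfold_locales
  qed (use q n t b6 p1 p2 r1 r2 S in \<open>auto simp: good_def\<close>)
qed

lemma ex_lax_pair:
  assumes q: "norm q < 1" "q \<noteq> 0" and t: "t \<noteq> 0" and b6: "b 6 \<noteq> 0"
    and A: "spectral_system q (G t) (\<lambda>y. weight q b y t) (\<lambda>k. p k t) b t n S Wp Tp Tm Wm"
    and B: "spectral_system q (G (q * t)) (\<lambda>y. weight q b y (q * t)) (\<lambda>k. p k (q * t)) b (q * t) n S' Wp' Tp' Tm' Wm'"
    and def: "stieltjes_deformation_eq q b G t"
  shows "\<exists>T. lax_pair q (G t) (\<lambda>y. weight q b y t) (\<lambda>k. p k t) b t n S Wp Tp Tm Wm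
     (G (q * t)) (\<lambda>y. weight q b y (q * t)) (\<lambda>k. p k (q * t)) S' Wp' Tp' Tm' Wm' T"
proof -
  interpret A: spectral_system q "G t" "\<lambda>y. weight q b y t" "\<lambda>k. p k t" b t n S Wp Tp Tm Wm by fact
  interpret B: spectral_system q "G (q * t)" "\<lambda>y. weight q b y (q * t)" "\<lambda>k. p k (q * t)" b "q * t" n S' Wp' Tp' Tm' Wm'
    by fact
  have phi: "stieltjes q b G x t = A.phi x" "stieltjes q b G x (q * t) = B.phi x" for x
    by (simp_all add: stieltjes_def A.phi_def A.cauchy_def B.phi_def B.cauchy_def)
  obtain T where T: "\<And>x. x \<noteq> 0 \<Longrightarrow> x \<notin> A.nodes \<Longrightarrow> x \<notin> B.nodes \<Longrightarrow>
      E_minus q b x t * B.phi x = E_plus q b x t * A.phi x + (q - 1) * t * poly T x"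
    using def unfolding stieltjes_deformation_eq_def phi by blast
  \<comment> \<open>Both points satisfy \<open>b 6 * x / t = 1\<close> for their own deformation
    variable, and \<open>(1; q)_inf = 0\<close> then stands in the denominator of the
    weight.\<close>
  have *: "b 6 * (t / b 6) * inverse t = 1" "b 6 * (q * (t / b 6)) * inverse (q * t) = 1"
    using q t b6 by (simp_all add: field_simps)
  have "weight q b (t / b 6) t = 0" "weight q b (q * (t / b 6)) (q * t) = 0"
    unfolding weight_def * qpoch_inf_1[OF q(1)] by simp_all
  hence ax: "lax_pair_axioms q (G t) (\<lambda>y. weight q b y t) b t
     (G (q * t)) (\<lambda>y. weight q b y (q * t)) T"
    using T by (intro lax_pair_axioms.intro) (auto simp: A.good_def B.good_def)
  show ?thesis by (rule exI, rule lax_pair.intro[OF A B ax])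
qed

context lax_pair begin

lemma mixed_relation:
  assumes pd: "pd \<noteq> 0" and Tp: "\<And>x. poly Tp x = coeff Tp 2 * x * (x - g)"
    and H: "\<And>x. q * t * H x = pd * (1 - f * x)"
    and const: "A.c * coeff Tp 2 * (q * t) * (lc / lc') = pd * (f - b 5 * q * t)"
    and C: "lc' * C' / (lc * C) = b 6 * q * t / (g * (b 5 * q * t - f))"
    and nz: "C \<noteq> 0" "C' \<noteq> 0" "g \<noteq> 0" "f \<noteq> b 5 * q * t"
  shows "(1 - b 2 * x) * (1 - b 3 * x) * pn x - (1 - b 6 * x * inverse t) * (1 - f * x) * pn (q * x)
     - q * x * (x - g) * C / (g * C') * pn' (q * x) = 0"
proof -
  have lcs: "lc \<noteq> 0" "lc' \<noteq> 0" using A.lead_coeff_p_nonzero B.lead_coeff_p_nonzero by auto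
  have clear: "k * q = r * m / (t * l)" if "k * (q * t) * (l / m) = r" "l \<noteq> 0" "m \<noteq> 0" for k l m r
    unfolding that(1)[symmetric] using that(2,3) A.t_nz by simp
  have "A.c * coeff Tp 2 * q = pd * (f - b 5 * q * t) * lc' / (t * lc)"
    by (rule clear[OF const lcs])
  also have "\<dots> = pd * (f - b 5 * q * t) / t * ((lc' * C' / (lc * C)) * (C / C'))"
    using nz lcs by (simp add: field_simps)
  \<comment> \<open>The minus sign arises from \<open>f - b 5 * q * t\<close> against
    \<open>b 5 * q * t - f\<close> in the equation for \<open>C\<close>; the last term of the mixed
    equation needs it.\<close>
  also have "\<dots> = - (b 6 * pd) * (q * C / (g * C'))"
    unfolding C using nz(1-3) A.t_nz right_minus_eq[of f "b 5 * q * t"] nz(4)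
    by (simp add: divide_simps) algebra
  finally have tau: "A.c * coeff Tp 2 * q = - (b 6 * pd) * (q * C / (g * C'))" .
  have H': "q * b 6 * (t - b 6 * x) * H x = b 6 * pd * ((1 - b 6 * x * inverse t) * (1 - f * x))"
  proof -
    have "q * b 6 * (t - b 6 * x) * H x = b 6 * (1 - b 6 * x * inverse t) * (q * t * H x)"
      using A.t_nz by (simp add: field_simps)
    thus ?thesis unfolding H by (simp add: mult_ac)
  qed
  have T': "q * A.c * poly Tp x = - (b 6 * pd) * (q * C / (g * C')) * (x * (x - g))"
    unfolding Tp tau[symmetric] by (simp only: mult_ac)
  have "(b 6 * pd) * ((1 - b 2 * x) * (1 - b 3 * x) * pn x - (1 - b 6 * x * inverse t) * (1 - f * x) * pn (q * x)
     - q * x * (x - g) * C / (g * C') * pn' (q * x)) = 0"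
    using three_term[of x] unfolding H' T' by (simp add: algebra_simps)
  thus ?thesis using pd A.b6_nz by (simp only: mult_eq_0_iff) simp
qed

end

context spectral_system begin

text \<open>The forward relation at \<open>x\<close> and the inverse relation at
  \<open>x / q\<close> both involve \<open>p n\<close> and \<open>p (n - 1)\<close> at
  \<open>x\<close>. After division by \<open>x * (x - g)\<close> and \<open>x * (x - q * g)\<close>
  the coefficients of \<open>p (n - 1)\<close> are opposite constants, so the sum eliminates
  it.\<close>

lemma second_order_relation:
  assumes Tp: "\<And>x. poly Tp x = coeff Tp 2 * x * (x - g)" and tau: "coeff Tp 2 \<noteq> 0"
    and x: "x \<noteq> 0" "x \<noteq> g" "x \<noteq> q * g"
  shows "b 6 * (1 - b 1 * x) * (1 - b 4 * x) * (t - b 6 * x) / (x * (x - g)) * poly (p n) (q * x)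
     + (1 - b 2 * (x / q)) * (1 - b 3 * (x / q)) * (b 6 * t - x / q) * q ^ 2 / (x * (x - q * g)) * poly (p n) (x / q)
     = (poly Wp x / (x * (x - g)) + q ^ 2 * poly Wm (x / q) / (x * (x - q * g))) * poly (p n) x"
proof -
  have e1: "D_plus b x t * poly (p n) (q * x) = poly Wp x * poly (p n) x - coeff Tp 2 * (x * (x - g)) * poly (p (n - 1)) x"
    using p_spectral[of x] Tp[of x] by (simp add: mult.assoc)
  have e2: "D_minus b (x / q) t * q ^ 2 * poly (p n) (x / q) = q ^ 2 * poly Wm (x / q) * poly (p n) x + coeff Tp 2 * (x * (x - q * g)) * poly (p (n - 1)) x"
  proof -
    have sc: "q ^ 2 * ((x / q) * (x / q - g)) = x * (x - q * g)" "q * (x / q) = x"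
      using q_nz by (simp_all add: field_simps power2_eq_square)
    have "D_minus b (x / q) t * q ^ 2 * poly (p n) (x / q) =
        q ^ 2 * (poly Wm (x / q) * poly (p n) x + poly Tp (x / q) * poly (p (n - 1)) x)"
      using p_inverse[of "x / q"] unfolding sc(2) by (simp only: mult_ac)
    also have "\<dots> = q ^ 2 * poly Wm (x / q) * poly (p n) x
        + coeff Tp 2 * (q ^ 2 * ((x / q) * (x / q - g))) * poly (p (n - 1)) x"
      unfolding Tp[of "x / q"] by (simp only: ring_distribs mult_ac)
    finally show ?thesis unfolding sc(1) .
  qed
  define u where "u = x * (x - g)"
  define v where "v = x * (x - q * g)"
  have uv: "u \<noteq> 0" "v \<noteq> 0" using x by (auto simp: u_def v_def)
  have "D_plus b x t / u * poly (p n) (q * x) = poly Wp x / u * poly (p n) x - coeff Tp 2 * poly (p (n - 1)) x"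
    using e1 uv unfolding u_def[symmetric] by (simp add: field_simps)
  moreover have "D_minus b (x / q) t * q ^ 2 / v * poly (p n) (x / q) = q ^ 2 * poly Wm (x / q) / v * poly (p n) x + coeff Tp 2 * poly (p (n - 1)) x"
    using e2 uv unfolding v_def[symmetric] by (simp add: field_simps)
  ultimately show ?thesis
    unfolding u_def[symmetric] v_def[symmetric] D_plus_def D_minus_def by (simp add: distrib_right)
qed

end

subsection \<open>The gauge transformation\<close>

lemma q_character_shift:
  assumes "q_character q e" "q \<noteq> 0" "t \<noteq> 0" "x \<noteq> 0"
  shows "e (t powi (- 2)) (q * x) = e (t powi (- 2)) x / t ^ 2"
    and "e ((q * t) powi (- 2)) (q * x) = e (t powi (- 2)) x / (q ^ 2 * t ^ 2 * x ^ 2)"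
proof -
  have ch: "e s (q * z) = s * e s z" "e (q * s) z = z * e s z" if "s \<noteq> 0" "z \<noteq> 0" for s z
    using assms(1) that unfolding q_character_def by blast+
  have powi: "s powi (- 2) = 1 / s ^ 2" for s :: complex
    by (simp add: power_int_minus divide_inverse)
  \<comment> \<open>Since \<open>t powi (- 2) = q ^ 2 * s\<close>, two uses of the rule for
    \<open>e (q * s)\<close> connect the characters at \<open>t\<close> and
    \<open>q * t\<close>.\<close>
  define s where "s = 1 / (q * t) ^ 2"
  have s: "s \<noteq> 0" "q * s \<noteq> 0" "1 / t ^ 2 = q * (q * s)" "1 / t ^ 2 \<noteq> 0"
    using assms(2,3) by (auto simp: s_def field_simps power2_eq_square)
  show "e (t powi (- 2)) (q * x) = e (t powi (- 2)) x / t ^ 2"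
    unfolding powi ch(1)[OF s(4) assms(4)] by simp
  have "e (1 / t ^ 2) x = x ^ 2 * e s x"
    unfolding s(3) ch(2)[OF s(2) assms(4)] ch(2)[OF s(1) assms(4)] by (simp add: power2_eq_square)
  thus "e ((q * t) powi (- 2)) (q * x) = e (t powi (- 2)) x / (q ^ 2 * t ^ 2 * x ^ 2)"
    unfolding powi s_def[symmetric] ch(1)[OF s(1) assms(4)]
    using assms(2-4) by (simp add: s_def field_simps)
qed

text \<open>The shift in \<open>x\<close> alone strips a factor from all three products, while the
  diagonal shift leaves the one in \<open>b 6 * x / t\<close> unchanged. \<open>A\<close> collects
  what is common.\<close>

lemma gauge_shift:
  assumes q: "norm q < 1" "q \<noteq> 0" and ch: "q_character q e" and tx: "t \<noteq> 0" "x \<noteq> 0"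
    and reg: "gauge_regular q b e x t"
  obtains A where "A \<noteq> 0" "1 - b 6 * x * inverse t \<noteq> 0" "1 - b 2 * x \<noteq> 0" "1 - b 3 * x \<noteq> 0"
    "gauge q b e C x t = A * (1 - b 6 * x * inverse t) * C t / ((1 - b 2 * x) * (1 - b 3 * x))"
    "gauge q b e C (q * x) t = A * C t / t ^ 2"
    "gauge q b e C (q * x) (q * t) = A * (1 - b 6 * x * inverse t) * C (q * t) / (q ^ 2 * t ^ 2 * x ^ 2)"
proof -
  have r: "qpoch_inf q (c * x) = (1 - c * x) * qpoch_inf q (c * (q * x))"
          "qpoch_inf q (c * x * d) = (1 - c * x * d) * qpoch_inf q (c * (q * x) * d)" for c d
    using qpoch_inf_rec[OF q(1), of "c * x"] qpoch_inf_rec[OF q(1), of "c * x * d"]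
    by (simp_all add: mult_ac)
  have arg: "b 6 * (q * x) * inverse (q * t) = b 6 * x * inverse t"
    using q(2) by (simp add: field_simps)
  define A where "A = e (t powi (- 2)) x * (qpoch_inf q (b 6 * (q * x) * inverse t) /
      (qpoch_inf q (b 2 * (q * x)) * qpoch_inf q (b 3 * (q * x))))"
  note reg' = reg[unfolded gauge_regular_def r]
  show ?thesis
  proof (rule that[of A])
    show "A \<noteq> 0" "1 - b 6 * x * inverse t \<noteq> 0" "1 - b 2 * x \<noteq> 0" "1 - b 3 * x \<noteq> 0"
      using reg' by (auto simp: A_def)
    show "gauge q b e C x t = A * (1 - b 6 * x * inverse t) * C t / ((1 - b 2 * x) * (1 - b 3 * x))"
      unfolding gauge_def A_def r(1)[of "b 2"] r(1)[of "b 3"] r(2) by (simp add: mult_ac)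
    show "gauge q b e C (q * x) t = A * C t / t ^ 2"
      unfolding gauge_def A_def q_character_shift(1)[OF ch q(2) tx] by (simp add: mult_ac)
    show "gauge q b e C (q * x) (q * t) = A * (1 - b 6 * x * inverse t) * C (q * t) / (q ^ 2 * t ^ 2 * x ^ 2)"
      unfolding gauge_def A_def q_character_shift(2)[OF ch q(2) tx] arg r(2) by (simp add: mult_ac)
  qed
qed

section \<open>Comparison with Yamada's pair\<close>

lemma prod_1_4: "(\<Prod>j=1..4. h j) = h 1 * h 2 * h 3 * h (4::nat)" for h :: "nat \<Rightarrow> complex"
proof -
  have "{1..4::nat} = {1, 2, 3, 4}" by auto
  thus ?thesis by (simp add: mult.assoc)
qed

text \<open>The left sides differ by the nonzero factor \<open>q / (f * x)\<close>.\<close>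

lemma yamada_deformation_iff:
  assumes "q \<noteq> 0" "f \<noteq> 0" "x \<noteq> 0"
  shows "yamada_deformation_eq q f g (\<lambda>z s. V (q * z) s) x t \<longleftrightarrow> mixed_eq q f g V x t"
proof -
  define k where "k = q / (f * x)"
  have eqs: "q * (x / q) = x" "q * t ^ 2 / (f * x) = k * t ^ 2" "q * ((1 - f * x) / (f * x)) = k * (1 - f * x)"
      "(x - g) / (f * g * x ^ 2) = k * ((x - g) / (q * g * x))"
    using assms by (simp_all add: k_def power2_eq_square)
  have factor: "k * a * u - k * b * v - k * c * w = k * (a * u - b * v - c * w)" for a b c u v w
    by (simp add: algebra_simps)
  have "q * t ^ 2 / (f * x) * V (q * (x / q)) t - q * ((1 - f * x) / (f * x)) * V (q * x) t
      - (x - g) / (f * g * x ^ 2) * V (q * x) (q * t) =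
    k * (t^2 * V x t - (1 - f * x) * V (q * x) t - (x - g) / (q * g * x) * V (q * x) (q * t))"
    unfolding eqs by (rule factor)
  moreover have "k \<noteq> 0" using assms by (simp add: k_def)
  ultimately show ?thesis unfolding yamada_deformation_eq_def mixed_eq_def by simp
qed

lemma yamada_spectral_iff:
  assumes "q \<noteq> 0"
  shows "yamada_spectral_eq q b f g (\<lambda>z s. V (q * z) s) x t \<longleftrightarrow> second_order_eq q b f g V x t"
proof -
  have "(\<Prod>j=1..4. b j - f) = (\<Prod>j=1..4. f - b j)" unfolding prod_1_4 by algebra
  moreover have "q * (x / q) = x" "q * (x / q ^ 2) = x / q"
    using assms by (simp_all add: field_simps power2_eq_square)
  ultimately show ?thesis unfolding yamada_spectral_eq_def second_order_eq_def by simp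
qed

section \<open>From relations between the polynomials to equations for \<open>U\<close>\<close>

lemma mixed_eq_gauge:
  fixes A B :: complex
  assumes "c2 * c3 * P - B * (1 - f * x) * P1 - q * x * (x - g) * C / (g * C') * P' = 0"
    and "A \<noteq> 0" "B \<noteq> 0" "c2 \<noteq> 0" "c3 \<noteq> 0" "C \<noteq> 0" "C' \<noteq> 0" "t \<noteq> 0" "q \<noteq> 0" "x \<noteq> 0" "g \<noteq> 0"
  shows "t ^ 2 * (P / (A * B * C / (c2 * c3))) - (1 - f * x) * (P1 / (A * C / t ^ 2))
    - (x - g) / (q * g * x) * (P' / (A * B * C' / (q ^ 2 * t ^ 2 * x ^ 2))) = 0"
proof -
  have "t ^ 2 * (P / (A * B * C / (c2 * c3))) - (1 - f * x) * (P1 / (A * C / t ^ 2))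
    - (x - g) / (q * g * x) * (P' / (A * B * C' / (q ^ 2 * t ^ 2 * x ^ 2)))
    = t ^ 2 / (A * B * C) * (c2 * c3 * P - B * (1 - f * x) * P1 - q * x * (x - g) * C / (g * C') * P')"
    using assms(2-) by (simp add: divide_simps) algebra
  thus ?thesis using assms(1) by simp
qed

text \<open>\<open>A\<close> and \<open>A'\<close> are the common factors obtained from
  \<open>x\<close> and from \<open>x / q\<close>, and \<open>F\<close> is the gauge at
  \<open>x\<close> written in either way. Measured against \<open>F\<close>, the gauges at both
  neighbours become rational.\<close>

lemma second_order_gauge:
  fixes A A' P P1 Pm Br b1 b2 b3 b4 b6 :: complex
  assumes rel: "b6 * (1 - b1 * x) * (1 - b4 * x) * (t - b6 * x) / (x * (x - g)) * P1
     + d2 * d3 * (b6 * t - x / q) * q ^ 2 / (x * (x - q * g)) * Pm = - (b6 * t) * Br * P"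
    and F: "F = A * (1 - b6 * x * inverse t) * C / ((1 - b2 * x) * (1 - b3 * x))"
    and F': "F = A' * C / t ^ 2"
    and nz: "A \<noteq> 0" "A' \<noteq> 0" "C \<noteq> 0" "1 - b6 * x * inverse t \<noteq> 0" "1 - b2 * x \<noteq> 0" "1 - b3 * x \<noteq> 0"
      "1 - b6 * (x / q) * inverse t \<noteq> 0" "d2 \<noteq> 0" "d3 \<noteq> 0" "t \<noteq> 0" "q \<noteq> 0" "b6 \<noteq> 0"
      "x \<noteq> 0" "x \<noteq> g" "x \<noteq> q * g"
  shows "((1 - b1 * x) * (1 - b2 * x) * (1 - b3 * x) * (1 - b4 * x)) / (t ^ 2 * x * (x - g)) * (P1 / (A * C / t ^ 2))
     + Br * (P / F)
     + (x - b6 * q * t) * (b6 * x - q * t) / (b6 * x * (x - q * g)) *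
       (Pm / (A' * (1 - b6 * (x / q) * inverse t) * C / (d2 * d3))) = 0"
proof -
  define u where "u = x * (x - g)"
  define v where "v = x * (x - q * g)"
  have uv: "u \<noteq> 0" "v \<noteq> 0" using nz by (auto simp: u_def v_def)
  have Fnz: "F \<noteq> 0" unfolding F' using nz by simp
  have B: "t - b6 * x = t * (1 - b6 * x * inverse t)" "b6 * x - q * t = - (q * t) * (1 - b6 * (x / q) * inverse t)"
    using nz(10,11) by (simp_all add: field_simps)
  have AC: "A * C / t ^ 2 = F * ((1 - b2 * x) * (1 - b3 * x)) / (t ^ 2 * (1 - b6 * x * inverse t))"
    unfolding F using nz by simp
  have AC': "A' * (1 - b6 * (x / q) * inverse t) * C / (d2 * d3) = F * t ^ 2 * (1 - b6 * (x / q) * inverse t) / (d2 * d3)"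
    unfolding F' using nz by simp
  have 1: "((1 - b1 * x) * (1 - b2 * x) * (1 - b3 * x) * (1 - b4 * x)) / (t ^ 2 * x * (x - g)) * (P1 / (A * C / t ^ 2))
      = 1 / (b6 * t * F) * (b6 * (1 - b1 * x) * (1 - b4 * x) * (t - b6 * x) / u * P1)"
    unfolding AC mult.assoc[of "t ^ 2" x] u_def[symmetric] B(1)
    using nz(4-6,10,12) uv Fnz by (simp add: divide_simps)
  have 2: "(x - b6 * q * t) * (b6 * x - q * t) / (b6 * x * (x - q * g)) *
       (Pm / (A' * (1 - b6 * (x / q) * inverse t) * C / (d2 * d3)))
      = 1 / (b6 * t * F) * (d2 * d3 * (b6 * t - x / q) * q ^ 2 / v * Pm)"
    unfolding AC' mult.assoc[of b6 x] v_def[symmetric] B(2)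
    using nz(7-12) uv Fnz by (simp add: divide_simps) algebra
  have "1 / (b6 * t * F) * (b6 * (1 - b1 * x) * (1 - b4 * x) * (t - b6 * x) / u * P1)
     + Br * (P / F) + 1 / (b6 * t * F) * (d2 * d3 * (b6 * t - x / q) * q ^ 2 / v * Pm) =
     1 / (b6 * t * F) * (- (b6 * t) * Br * P) + Br * (P / F)"
    unfolding rel[folded u_def v_def, symmetric] by (simp add: distrib_left)
  also have "\<dots> = 0" using nz Fnz by simp
  finally show ?thesis unfolding 1 2 .
qed

theorem mainTheorem9:
  fixes q t0 :: complex and b :: "nat \<Rightarrow> complex" and n :: nat
    and G :: "complex \<Rightarrow> (complex \<times> complex) list"
    and p :: "nat \<Rightarrow> complex \<Rightarrow> complex poly"
    and Wp Tp Tm Wm :: "complex \<Rightarrow> complex poly"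
    and f g C :: "complex \<Rightarrow> complex"
    and e :: "complex \<Rightarrow> complex \<Rightarrow> complex"
    and U Y :: "complex \<Rightarrow> complex \<Rightarrow> complex"
  assumes q: "0 < norm q" "norm q < 1"
    and n: "n \<ge> 1"
    and b_nz: "b 1 \<noteq> 0" "b 2 \<noteq> 0" "b 3 \<noteq> 0" "b 4 \<noteq> 0" "b 6 \<noteq> 0"
    and b_prod: "b 1 * b 2 * b 3 * b 4 = 1"
    and b5: "b 5 = b 1 * b 4 * b 6 * q ^ n"
    and b5_generic: "(b 5)^2 \<noteq> inverse q" "(b 5)^2 \<noteq> 1" "(b 5)^2 \<noteq> q"
    and t0: "t0 \<noteq> 0"
    and char_e: "q_character q e"
    and spectral_eq: "\<forall>t\<in>q_lattice q t0. stieltjes_spectral_eq q b G t"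
    and deformation_eq: "\<forall>t\<in>q_lattice q t0. stieltjes_deformation_eq q b G t"
    and orthonormal: "\<forall>t\<in>q_lattice q t0. orthonormal_polys q b G p t"
    and A: "\<forall>t\<in>q_lattice q t0. spectral_matrix q b G p n t
              (vector [vector [Wp t, - Tp t], vector [Tm t, Wm t]])"
    and g: "\<forall>t\<in>q_lattice q t0. \<exists>L. Tp t = [:0, 1:] * L \<and> degree L = 1 \<and> poly L (g t) = 0"
    and f: "\<forall>t\<in>q_lattice q t0.
              poly (Wp t) (g t) =
              - (1 / t) * (g t - b 6 * t) * (b 6 * g t - t) * (f (t / q) * g t - 1)"
    and generic: "\<forall>t\<in>q_lattice q t0.
              g t \<noteq> 0 \<and> g t \<noteq> b 6 * t \<and> b 6 * g t \<noteq> t \<and>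
              f t \<noteq> 0 \<and> f t * g t \<noteq> 1 \<and> f t \<noteq> b 5 * q * t"
    and C_nz: "\<forall>t\<in>q_lattice q t0. C t \<noteq> 0"
    and C: "\<forall>t\<in>q_lattice q t0.
              (lead_coeff (p n (q * t)) * C (q * t)) / (lead_coeff (p n t) * C t) =
              b 6 * q * t / (g t * (b 5 * q * t - f t))"
    and U: "\<And>x t. U x t = poly (p n t) x / gauge q b e C x t"
    and Y: "\<And>z t. Y z t = U (q * z) t"
  shows "\<forall>t\<in>q_lattice q t0.
           (\<forall>x. x \<noteq> 0 \<and> gauge_regular q b e x t \<longrightarrow>
              mixed_eq q (f t) (g t) U x t \<and>
              yamada_deformation_eq q (f t) (g t) Y x t) \<and>
           (\<forall>x. x \<noteq> 0 \<and> x \<noteq> g t \<and> x \<noteq> q * g t \<and> f t * x \<noteq> 1 \<and>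
                gauge_regular q b e x t \<and> gauge_regular q b e (x / q) t \<longrightarrow>
              second_order_eq q b (f t) (g t) U x t \<and>
              yamada_spectral_eq q b (f t) (g t) Y x t) \<and>
           (\<forall>V x. x \<noteq> 0 \<longrightarrow>
              (mixed_eq q (f t) (g t) V x t \<longleftrightarrow>
                 yamada_deformation_eq q (f t) (g t) (\<lambda>z s. V (q * z) s) x t) \<and>
              (second_order_eq q b (f t) (g t) V x t \<longleftrightarrow>
                 yamada_spectral_eq q b (f t) (g t) (\<lambda>z s. V (q * z) s) x t))"
proof -
  have q0: "q \<noteq> 0" and q1: "norm q < 1" using q by auto
  have lattice: "t \<noteq> 0" "q * t \<in> q_lattice q t0" if t: "t \<in> q_lattice q t0" for t
  proof -
    obtain k :: int where k: "t = t0 * q powi k" using t by (auto simp: q_lattice_def)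
    show "t \<noteq> 0" using k t0 q0 by simp
    have "q * t = t0 * q powi (k + 1)" using k q0 by (simp add: power_int_add)
    thus "q * t \<in> q_lattice q t0" unfolding q_lattice_def by blast
  qed
  have Y_eq: "Y = (\<lambda>z s. U (q * z) s)" by (intro ext) (rule Y)
  have iffs: "mixed_eq q (f t) (g t) V x t \<longleftrightarrow> yamada_deformation_eq q (f t) (g t) (\<lambda>z s. V (q * z) s) x t"
      "second_order_eq q b (f t) (g t) V x t \<longleftrightarrow> yamada_spectral_eq q b (f t) (g t) (\<lambda>z s. V (q * z) s) x t"
    if "t \<in> q_lattice q t0" "x \<noteq> 0" for V x t
  proof -
    have "f t \<noteq> 0" using generic that(1) by simp
    thus "mixed_eq q (f t) (g t) V x t \<longleftrightarrow> yamada_deformation_eq q (f t) (g t) (\<lambda>z s. V (q * z) s) x t"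
      using yamada_deformation_iff[OF q0 _ that(2)] by simp
    show "second_order_eq q b (f t) (g t) V x t \<longleftrightarrow> yamada_spectral_eq q b (f t) (g t) (\<lambda>z s. V (q * z) s) x t"
      by (rule yamada_spectral_iff[OF q0, symmetric])
  qed
  have "(x \<noteq> 0 \<and> gauge_regular q b e x t \<longrightarrow> mixed_eq q (f t) (g t) U x t) \<and>
      (x \<noteq> 0 \<and> x \<noteq> g t \<and> x \<noteq> q * g t \<and> f t * x \<noteq> 1 \<and>
         gauge_regular q b e x t \<and> gauge_regular q b e (x / q) t \<longrightarrow> second_order_eq q b (f t) (g t) U x t)"
    if t: "t \<in> q_lattice q t0" for x t
  proof -
    note t' = lattice[OF t]
    note qt_nz = lattice(1)[OF t'(2)]
    note gen = generic[rule_format, OF t] and gen' = generic[rule_format, OF t'(2)]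
    obtain S where S: "spectral_system q (G t) (\<lambda>y. weight q b y t) (\<lambda>k. p k t) b t n S (Wp t) (Tp t) (Tm t) (Wm t)"
      using ex_spectral_system[where b = b and G = G and p = p, OF q1 q0 n t'(1) b_nz(5) spectral_eq[rule_format, OF t]
        orthonormal[rule_format, OF t] A[rule_format, OF t]] by blast
    obtain S' where S': "spectral_system q (G (q * t)) (\<lambda>y. weight q b y (q * t)) (\<lambda>k. p k (q * t)) b (q * t) n S'
        (Wp (q * t)) (Tp (q * t)) (Tm (q * t)) (Wm (q * t))"
      using ex_spectral_system[where b = b and G = G and p = p, OF q1 q0 n qt_nz b_nz(5) spectral_eq[rule_format, OF t'(2)]
        orthonormal[rule_format, OF t'(2)] A[rule_format, OF t'(2)]] by blast
    obtain T where T: "lax_pair q (G t) (\<lambda>y. weight q b y t) (\<lambda>k. p k t) b t n S (Wp t) (Tp t) (Tm t) (Wm t)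
        (G (q * t)) (\<lambda>y. weight q b y (q * t)) (\<lambda>k. p k (q * t)) S'
        (Wp (q * t)) (Tp (q * t)) (Tm (q * t)) (Wm (q * t)) T"
      using ex_lax_pair[where b = b and G = G and p = p, OF q1 q0 t'(1) b_nz(5) S S' deformation_eq[rule_format, OF t]] by blast
    interpret lax_pair q "G t" "\<lambda>y. weight q b y t" "\<lambda>k. p k t" b t n S "Wp t" "Tp t" "Tm t" "Wm t"
        "G (q * t)" "\<lambda>y. weight q b y (q * t)" "\<lambda>k. p k (q * t)" S'
        "Wp (q * t)" "Tp (q * t)" "Tm (q * t)" "Wm (q * t)" T
      by (rule T)
    obtain L where L: "Tp t = [:0, 1:] * L" "degree L = 1" "poly L (g t) = 0"
      using g t by blast
    note tau = quadratic_from_root(1)[OF L] and Tp = quadratic_from_root(2)[OF L]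
    have Tp_g: "poly (Tp t) (g t) = 0" by (simp add: Tp)
    have Tp'_g: "poly (Tp (q * t)) (g (q * t)) = 0" using g t'(2) by fastforce
    have pd: "pd \<noteq> 0" using pd_nonzero[OF tau Tp] gen by blast
    \<comment> \<open>The definition of the variable is applied at \<open>q * t\<close>, where
      \<open>f (q * t / q)\<close> is \<open>f t\<close>.\<close>
    have "poly (Wp (q * t)) (g (q * t)) =
        - (1 / (q * t)) * (g (q * t) - b 6 * (q * t)) * (b 6 * g (q * t) - q * t) * (f t * g (q * t) - 1)"
      using f[rule_format, OF t'(2)] q0 by simp
    note H = H_from_f[OF pd Tp'_g this]
    have H: "\<And>x. q * t * H x = pd * (1 - f t * x)" "q * t * h1 = - (pd * f t)"
      using H gen' by blast+
    note const = gauge_constant[OF H(2) b5]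
    have CC: "C t \<noteq> 0" "C (q * t) \<noteq> 0" using C_nz t t'(2) by blast+
    have mixed: "(1 - b 2 * x) * (1 - b 3 * x) * poly (p n t) x - (1 - b 6 * x * inverse t) * (1 - f t * x) * poly (p n t) (q * x)
       - q * x * (x - g t) * C t / (g t * C (q * t)) * poly (p n (q * t)) (q * x) = 0"
      using mixed_relation[OF pd Tp H(1) const C[rule_format, OF t] CC] gen by blast
    have Wm_g: "t * poly (Wm t) (g t) = (t - b 6 * g t) * (b 6 * t - g t) * (1 - f t * g t)"
      by (rule Wm_at_root[OF pd Tp_g H(1)])
    have Wp_g: "poly (Wp t) (g t) * (1 - f t * g t) =
        b 6 * t * ((1 - b 1 * g t) * (1 - b 2 * g t) * (1 - b 3 * g t) * (1 - b 4 * g t))"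
      using Wp_at_root[OF Tp_g Wm_g] gen by blast
    define e1 where "e1 = b 1 + b 2 + b 3 + b 4"
    define e2 where "e2 = b 1 * b 2 + b 1 * b 3 + b 1 * b 4 + b 2 * b 3 + b 2 * b 4 + b 3 * b 4"
    define e3 where "e3 = b 1 * b 2 * b 3 + b 1 * b 2 * b 4 + b 1 * b 3 * b 4 + b 2 * b 3 * b 4"
    have e_x: "(1 - b 1 * x) * (1 - b 2 * x) * (1 - b 3 * x) * (1 - b 4 * x) = 1 - e1 * x + e2 * x ^ 2 - e3 * x ^ 3 + x ^ 4" for x
      unfolding e1_def e2_def e3_def using b_prod by algebra
    have e_f: "(f t - b 1) * (f t - b 2) * (f t - b 3) * (f t - b 4) = f t ^ 4 - e1 * f t ^ 3 + e2 * f t ^ 2 - e3 * f t + 1"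
      unfolding e1_def e2_def e3_def using b_prod by algebra
    have b5_nz: "b 5 \<noteq> 0" using b5 b_nz q0 by simp
    have lead: "coeff (Wp t) 3 = - (b 6 * b 5)" "coeff (Wm t) 3 = - (b 6 / b 5)"
    proof -
      show "coeff (Wp t) 3 = - (b 6 * b 5)"
        using A.Wp_lead b5 by (simp add: power2_eq_square mult_ac)
      have "b 2 * b 3 / q ^ n = b 6 / b 5"
        unfolding b5 using b_nz q0 b_prod by (simp add: field_simps)
      thus "coeff (Wm t) 3 = - (b 6 / b 5)" using A.Wm_lead by simp
    qed
    have Wp_x: "poly (Wp t) y = b 6 * t + coeff (Wp t) 1 * y + coeff (Wp t) 2 * y ^ 2 + (- (b 6 * b 5)) * y ^ 3"
     and Wm_x: "poly (Wm t) y = b 6 * t + coeff (Wm t) 1 * y + coeff (Wm t) 2 * y ^ 2 + (- (b 6 / b 5)) * y ^ 3" for y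
      using A.Wp_lead A.Wm_lead A.at_0(1,2) lead poly_as_sum_le[of "Wp t" 3 y] poly_as_sum_le[of "Wm t" 3 y]
      by (simp_all add: poly_0_coeff_0 eval_nat_numeral)
    show ?thesis
    proof (intro conjI impI; elim conjE)
      assume x: "x \<noteq> 0" and reg: "gauge_regular q b e x t"
      obtain F where F: "F \<noteq> 0" "1 - b 6 * x * inverse t \<noteq> 0" "1 - b 2 * x \<noteq> 0" "1 - b 3 * x \<noteq> 0"
        "gauge q b e C x t = F * (1 - b 6 * x * inverse t) * C t / ((1 - b 2 * x) * (1 - b 3 * x))"
        "gauge q b e C (q * x) t = F * C t / t ^ 2"
        "gauge q b e C (q * x) (q * t) = F * (1 - b 6 * x * inverse t) * C (q * t) / (q ^ 2 * t ^ 2 * x ^ 2)"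
        using gauge_shift[OF q1 q0 char_e t'(1) x reg, where C = C] by blast
      show "mixed_eq q (f t) (g t) U x t"
        unfolding mixed_eq_def U F(5-7) using gen
        by (intro mixed_eq_gauge[OF mixed F(1-4) CC t'(1) q0 x]) blast
    next
      assume x: "x \<noteq> 0" "x \<noteq> g t" "x \<noteq> q * g t" "f t * x \<noteq> 1"
        and reg: "gauge_regular q b e x t" "gauge_regular q b e (x / q) t"
      have xq: "x / q \<noteq> 0" "q * (x / q) = x" using x q0 by simp_all
      obtain F where F: "F \<noteq> 0" "1 - b 6 * x * inverse t \<noteq> 0" "1 - b 2 * x \<noteq> 0" "1 - b 3 * x \<noteq> 0"
        "gauge q b e C x t = F * (1 - b 6 * x * inverse t) * C t / ((1 - b 2 * x) * (1 - b 3 * x))"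
        "gauge q b e C (q * x) t = F * C t / t ^ 2"
        using gauge_shift[OF q1 q0 char_e t'(1) x(1) reg(1), where C = C] by blast
      \<comment> \<open>Shifting up from \<open>x / q\<close> gives the gauge at \<open>x\<close> a
        second time, which relates \<open>F'\<close> to \<open>F\<close>.\<close>
      obtain F' where F': "F' \<noteq> 0" "1 - b 6 * (x / q) * inverse t \<noteq> 0" "1 - b 2 * (x / q) \<noteq> 0" "1 - b 3 * (x / q) \<noteq> 0"
        "gauge q b e C (x / q) t = F' * (1 - b 6 * (x / q) * inverse t) * C t / ((1 - b 2 * (x / q)) * (1 - b 3 * (x / q)))"
        "gauge q b e C x t = F' * C t / t ^ 2"
        using gauge_shift[OF q1 q0 char_e t'(1) xq(1) reg(2), where C = C] unfolding xq(2) by blast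
      define Br where "Br = - ((1 - b 1 * x) * (1 - b 2 * x) * (1 - b 3 * x) * (1 - b 4 * x)) / (x * (x - g t) * (1 - f t * x))
        + x * ((f t - b 1) * (f t - b 2) * (f t - b 3) * (f t - b 4)) / (f t * (1 - f t * g t) * (1 - f t * x))
        - x * (f t - b 5 * q * t) * (b 5 * f t - t) / (b 5 * q * t^2 * f t)
        - (x - b 6 * q * t) * (b 6 * x - q * t) * (q - f t * x) / (b 6 * q * t^2 * x * (x - q * g t))"
      have coefficient: "poly (Wp t) x / (x * (x - g t)) + q ^ 2 * poly (Wm t) (x / q) / (x * (x - q * g t)) = - (b 6 * t) * Br"
        unfolding Br_def e_x e_f Wp_x[of x] Wm_x[of "x / q"]
      proof (rule second_order_coefficient)
        show "b 6 * t + coeff (Wp t) 1 * g t + coeff (Wp t) 2 * g t ^ 2 + (- (b 6 * b 5)) * g t ^ 3 = poly (Wp t) (g t)"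
          by (rule Wp_x[symmetric])
        show "b 6 * t + coeff (Wm t) 1 * g t + coeff (Wm t) 2 * g t ^ 2 + (- (b 6 / b 5)) * g t ^ 3 = poly (Wm t) (g t)"
          by (rule Wm_x[symmetric])
        show "poly (Wp t) (g t) * (1 - f t * g t) = b 6 * t * (1 - e1 * g t + e2 * g t ^ 2 - e3 * g t ^ 3 + g t ^ 4)"
          using Wp_g unfolding e_x .
        show "coeff (Wp t) 1 + coeff (Wm t) 1 = - (b 6 * t * e1 + b 6 ^ 2 + 1)"
          using A.derivative_0 unfolding e1_def .
      qed (use x gen t'(1) q0 b5_nz b_nz Wm_g in auto)
      note rel = A.second_order_relation[OF Tp tau x(1-3), unfolded coefficient]
      show "second_order_eq q b (f t) (g t) U x t"
        unfolding second_order_eq_def U F(6) F'(5) prod_1_4 Br_def[symmetric]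
        by (rule second_order_gauge[OF rel F(5) F'(6) F(1) F'(1) CC(1) F(2-4) F'(2-4) t'(1) q0 b_nz(5) x(1-3)])
    qed
  qed
  thus ?thesis
    unfolding Y_eq using iffs by blast
qed

end
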